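(* Let $E$ be a finite directed graph and $p\colon E^1\to\mathbb N\setminus\{0\}$ a function, and let $(\mathcal G,F^* )$ be the associated matched pair (graph of odometers) described in the context. Let $M\colon\mathbb ZE^1\to\mathbb ZE^0$ be the homomorphism with $M(e)=p(e)\,r(e)-s(e)$ for $e\in E^1$. Then $$H_0^{\bowtie}(\mathcal G,F^* )\cong H_0(E),\qquad H_2^{\bowtie}(\mathcal G,F^* )\cong\ker(M),$$ and there is a short exact sequence $$0\longrightarrow H_1(E)\longrightarrow H_1^{\bowtie}(\mathcal G,F^* )\longrightarrow\operatorname{coker}(M)\longrightarrow 0.$$
   Context: Directed graphs and path categories. A directed graph $E=(E^0,E^1,r,s)$ has vertices $E^0$, edges $E^1$, range and source maps $r,s\colon E^1\to E^0$. Paths are $\mu=\mu_1\cdots\mu_n$ with $s(\mu_i)=r(\mu_{i+1})$, $r(\mu)=r(\mu_1)$, $s(\mu)=s(\mu_n)$; vertices are paths of length $0$. $E^*$ is the path category: morphisms are all finite paths, objects $E^0$, composition concatenation. Categorical homology. A small category $\mathcal E$ is identified with its set of morphisms, $\mathcal E^0$ its objects (identities), $r,s$ codomain and domain, $\mathcal E^k$ the composable $k$-tuples. $C_k(\mathcal E)=\mathbb Z\mathcal E^k$, with $d_k\colon C_{k+1}(\mathcal E)\to C_k(\mathcal E)$, $d_k[e_0,\dots,e_k]=[e_1,\dots,e_k]+\sum_{i=1}^k(-1)^i[e_0,\dots,e_{i-1}e_i,\dots,e_k]+(-1)^{k+1}[e_0,\dots,e_{k-1}]$ for $k\ge1$ and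 $d_0[e]=[s(e)]-[r(e)]$; $H_\bullet(\mathcal E)$ is the homology. For a directed graph, $H_\bullet(E):=H_\bullet(E^* )$. Matched pairs and Zappa–Szép products. A matched pair $(\mathcal C,\mathcal D)$ consists of small categories with $\mathcal C^0=\mathcal D^0$, a left action $\triangleright$ of $\mathcal C$ on $\mathcal D$ and a right action $\triangleleft$ of $\mathcal D$ on $\mathcal C$ (both defined on pairs $(c,d)$ with $s(c)=r(d)$) with $s(c\triangleright d)=r(c\triangleleft d)$, $c\triangleright(d_1d_2)=(c\triangleright d_1)((c\triangleleft d_1)\triangleright d_2)$, $(c_1c_2)\triangleleft d=(c_1\triangleleft(c_2\triangleright d))(c_2\triangleleft d)$. $\mathcal C\bowtie\mathcal D$ is the category with morphisms $dc:=(d,c)$, $s(d)=r(c)$, $r(dc)=r(d)$, $s(dc)=s(c)$, composition $(d_1c_1)(d_2c_2)=(d_1(c_1\triangleright d_2))((c_1\triangleleft d_2)c_2)$. $H^{\bowtie}_\bullet(\mathcal C,\mathcal D):=H_\bullet(\mathcal C\bowtie\mathcal D)$. The graph of odometers. Given $E$ and $p$, let $F^0=E^0$, $F^1=\{(e,i): e\in E^1,\ i\in\mathbb Z/p(e)\mathbb Z\}$, $r(e,i)=r(e)$, $s(e,i)=s(e)$. Let $\mathcal G=E^0\times\mathbb Z$, the groupoid that is a bundle of copies of $\mathbb Z$ over $E^0$. The matched pair structure on $(\mathcal G,F^* )$ is the unique extension, preserving path length, of $(r(e),1)\triangleright(e,i)=(e,i+1 \bmod p(e))$ and $(r(e),1)\triangleleft(e,i)=(s(e),1)$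 if $i=p(e)-1$, $=(s(e),0)$ otherwise. Explicitly, representing $i$ by an element of $\{0,\dots,p(e)-1\}$, $(r(e),a)\triangleright(e,i)=(e,a+i\bmod p(e))$, $(r(e),a)\triangleleft(e,i)=(s(e),\lfloor(a+i)/p(e)\rfloor)$ for $a\in\mathbb Z$, extended to paths by $g\triangleright(f\xi)=(g\triangleright f)((g\triangleleft f)\triangleright\xi)$ and $g\triangleleft(f\xi)=(g\triangleleft f)\triangleleft\xi$. *)

theory Defs
  imports "HOL-Algebra.Free_Abelian_Groups" "Graph_Theory.Digraph"
begin

text \<open>
  \<open>comp C e f\<close> is the composite \<open>ef\<close>, which is meaningful when \<open>src C e = rng C f\<close>.  Objects have a
  type of their own, so that two categories with different types of morphisms can have literally the
  same objects; an object \<open>x\<close> is identified with the morphism \<open>ident C x\<close>.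
\<close>

record ('o, 'm) category =
  Obj :: "'o set"
  Mor :: "'m set"
  src :: "'m \<Rightarrow> 'o"
  rng :: "'m \<Rightarrow> 'o"
  ident :: "'o \<Rightarrow> 'm"
  comp :: "'m \<Rightarrow> 'm \<Rightarrow> 'm"

locale small_category =
  fixes C :: "('o, 'm) category"
  assumes src_in: "e \<in> Mor C \<Longrightarrow> src C e \<in> Obj C"
    and rng_in: "e \<in> Mor C \<Longrightarrow> rng C e \<in> Obj C"
    and ident_in: "x \<in> Obj C \<Longrightarrow> ident C x \<in> Mor C"
    and src_ident: "x \<in> Obj C \<Longrightarrow> src C (ident C x) = x"
    and rng_ident: "x \<in> Obj C \<Longrightarrow> rng C (ident C x) = x"
    and comp_in: "\<lbrakk>e \<in> Mor C; f \<in> Mor C; src C e = rng C f\<rbrakk> \<Longrightarrow> comp C e f \<in> Mor C"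
    and src_comp: "\<lbrakk>e \<in> Mor C; f \<in> Mor C; src C e = rng C f\<rbrakk> \<Longrightarrow> src C (comp C e f) = src C f"
    and rng_comp: "\<lbrakk>e \<in> Mor C; f \<in> Mor C; src C e = rng C f\<rbrakk> \<Longrightarrow> rng C (comp C e f) = rng C e"
    and comp_ident_left: "e \<in> Mor C \<Longrightarrow> comp C (ident C (rng C e)) e = e"
    and comp_ident_right: "e \<in> Mor C \<Longrightarrow> comp C e (ident C (src C e)) = e"
    and comp_assoc: "\<lbrakk>e \<in> Mor C; f \<in> Mor C; g \<in> Mor C; src C e = rng C f; src C f = rng C g\<rbrakk>
      \<Longrightarrow> comp C (comp C e f) g = comp C e (comp C f g)"

text \<open>
  Composable \<open>k\<close>-tuples.  For \<open>k = 0\<close> these are the objects, represented by singleton lists of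
  identities so that all chain groups live in one type.
\<close>

definition nerve :: "('o, 'm) category \<Rightarrow> nat \<Rightarrow> 'm list set" where
  "nerve C k =
    (if k = 0 then {[ident C x] |x. x \<in> Obj C}
     else {es. length es = k \<and> set es \<subseteq> Mor C \<and> successively (\<lambda>e f. src C e = rng C f) es})"

definition chains :: "('o, 'm) category \<Rightarrow> nat \<Rightarrow> ('m list \<Rightarrow>\<^sub>0 int) monoid" where
  "chains C k = free_Abelian_group (nerve C k)"

text \<open>\<open>[e\<^sub>0, \<dots>, e\<^sub>k] \<mapsto> [e\<^sub>0, \<dots>, e\<^sub>i\<^sub>-\<^sub>1 e\<^sub>i, \<dots>, e\<^sub>k]\<close>, for \<open>1 \<le> i \<le> k\<close>\<close>

definition merge :: "('o, 'm) category \<Rightarrow> nat \<Rightarrow> 'm list \<Rightarrow> 'm list" where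
  "merge C i es = take (i - 1) es @ [comp C (es ! (i - 1)) (es ! i)] @ drop (i + 1) es"

text \<open>The map \<open>boundary C k\<close> goes from \<open>chains C (k + 1)\<close> to \<open>chains C k\<close>.\<close>

definition boundary_simplex :: "('o, 'm) category \<Rightarrow> nat \<Rightarrow> 'm list \<Rightarrow> 'm list \<Rightarrow>\<^sub>0 int" where
  "boundary_simplex C k es =
    (if k = 0 then frag_of [ident C (src C (hd es))] - frag_of [ident C (rng C (hd es))]
     else frag_of (tl es)
       + (\<Sum>i = 1..k. frag_cmul ((-1) ^ i) (frag_of (merge C i es)))
       + frag_cmul ((-1) ^ (k + 1)) (frag_of (butlast es)))"

definition boundary :: "('o, 'm) category \<Rightarrow> nat \<Rightarrow> ('m list \<Rightarrow>\<^sub>0 int) \<Rightarrow> 'm list \<Rightarrow>\<^sub>0 int" where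
  "boundary C k = frag_extend (boundary_simplex C k)"

fun cycles :: "('o, 'm) category \<Rightarrow> nat \<Rightarrow> ('m list \<Rightarrow>\<^sub>0 int) set" where
  "cycles C 0 = carrier (chains C 0)"
| "cycles C (Suc k) = kernel (chains C (Suc k)) (chains C k) (boundary C k)"

definition homology :: "('o, 'm) category \<Rightarrow> nat \<Rightarrow> ('m list \<Rightarrow>\<^sub>0 int) set monoid" where
  "homology C k =
    (chains C k)\<lparr>carrier := cycles C k\<rparr> Mod (boundary C k ` carrier (chains C (Suc k)))"

text \<open>\<open>l c d\<close> and \<open>r c d\<close> stand for \<open>c \<triangleright> d\<close> and \<open>c \<triangleleft> d\<close>; only pairs with \<open>src C c = rng D d\<close> matter.\<close>

locale matched_pair = C: small_category C + D: small_category D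
  for C :: "('o, 'c) category" and D :: "('o, 'd) category" +
  fixes l :: "'c \<Rightarrow> 'd \<Rightarrow> 'd" and r :: "'c \<Rightarrow> 'd \<Rightarrow> 'c"
  assumes Obj_eq: "Obj C = Obj D"
    and l_in: "\<lbrakk>c \<in> Mor C; d \<in> Mor D; src C c = rng D d\<rbrakk> \<Longrightarrow> l c d \<in> Mor D"
    and rng_l: "\<lbrakk>c \<in> Mor C; d \<in> Mor D; src C c = rng D d\<rbrakk> \<Longrightarrow> rng D (l c d) = rng C c"
    and l_ident: "d \<in> Mor D \<Longrightarrow> l (ident C (rng D d)) d = d"
    and l_comp: "\<lbrakk>c1 \<in> Mor C; c2 \<in> Mor C; d \<in> Mor D; src C c1 = rng C c2; src C c2 = rng D d\<rbrakk>
      \<Longrightarrow> l (comp C c1 c2) d = l c1 (l c2 d)"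
    and r_in: "\<lbrakk>c \<in> Mor C; d \<in> Mor D; src C c = rng D d\<rbrakk> \<Longrightarrow> r c d \<in> Mor C"
    and src_r: "\<lbrakk>c \<in> Mor C; d \<in> Mor D; src C c = rng D d\<rbrakk> \<Longrightarrow> src C (r c d) = src D d"
    and r_ident: "c \<in> Mor C \<Longrightarrow> r c (ident D (src C c)) = c"
    and r_comp: "\<lbrakk>c \<in> Mor C; d1 \<in> Mor D; d2 \<in> Mor D; src C c = rng D d1; src D d1 = rng D d2\<rbrakk>
      \<Longrightarrow> r c (comp D d1 d2) = r (r c d1) d2"
    and src_l: "\<lbrakk>c \<in> Mor C; d \<in> Mor D; src C c = rng D d\<rbrakk> \<Longrightarrow> src D (l c d) = rng C (r c d)"
    and l_comp_right: "\<lbrakk>c \<in> Mor C; d1 \<in> Mor D; d2 \<in> Mor D; src C c = rng D d1; src D d1 = rng D d2\<rbrakk>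
      \<Longrightarrow> l c (comp D d1 d2) = comp D (l c d1) (l (r c d1) d2)"
    and r_comp_left: "\<lbrakk>c1 \<in> Mor C; c2 \<in> Mor C; d \<in> Mor D; src C c1 = rng C c2; src C c2 = rng D d\<rbrakk>
      \<Longrightarrow> r (comp C c1 c2) d = comp C (r c1 (l c2 d)) (r c2 d)"

definition zappa_szep ::
  "('o, 'c) category \<Rightarrow> ('o, 'd) category \<Rightarrow> ('c \<Rightarrow> 'd \<Rightarrow> 'd) \<Rightarrow> ('c \<Rightarrow> 'd \<Rightarrow> 'c) \<Rightarrow> ('o, 'd \<times> 'c) category"
where
  "zappa_szep C D l r =
    \<lparr>Obj = Obj C,
     Mor = {(d, c). d \<in> Mor D \<and> c \<in> Mor C \<and> src D d = rng C c},
     src = (\<lambda>(d, c). src C c),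
     rng = (\<lambda>(d, c). rng D d),
     ident = (\<lambda>x. (ident D x, ident C x)),
     comp = (\<lambda>(d1, c1) (d2, c2). (comp D d1 (l c1 d2), comp C (r c1 d2) c2))\<rparr>"

text \<open>
  Directed graphs are those of the \<open>Graph_Theory\<close> library (loops and parallel arcs allowed), with
  \<open>r = head\<close> and \<open>s = tail\<close>.  A path is a pair \<open>(v, [\<mu>\<^sub>1, \<dots>, \<mu>\<^sub>n])\<close> whose first component is its range;
  \<open>(v, [])\<close> is the vertex \<open>v\<close>.  Since \<open>s(\<mu>\<^sub>i) = r(\<mu>\<^sub>i\<^sub>+\<^sub>1)\<close>, the arcs are listed against their direction.
\<close>

definition path_src :: "('v, 'e) pre_digraph \<Rightarrow> 'v \<times> 'e list \<Rightarrow> 'v" where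
  "path_src E = (\<lambda>(v, es). if es = [] then v else tail E (last es))"

definition path_category :: "('v, 'e) pre_digraph \<Rightarrow> ('v, 'v \<times> 'e list) category" where
  "path_category E =
    \<lparr>Obj = verts E,
     Mor = {(v, es). v \<in> verts E \<and> set es \<subseteq> arcs E \<and> (es \<noteq> [] \<longrightarrow> head E (hd es) = v)
              \<and> successively (\<lambda>e f. tail E e = head E f) es},
     src = path_src E,
     rng = fst,
     ident = (\<lambda>v. (v, [])),
     comp = (\<lambda>(v, es) (w, fs). (v, es @ fs))\<rparr>"

definition graph_homology :: "('v, 'e) pre_digraph \<Rightarrow> nat \<Rightarrow> (('v \<times> 'e list) list \<Rightarrow>\<^sub>0 int) set monoid" where
  "graph_homology E k = homology (path_category E) k"

definition odometer_graph :: "('v, 'e) pre_digraph \<Rightarrow> ('e \<Rightarrow> nat) \<Rightarrow> ('v, 'e \<times> int) pre_digraph" where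
  "odometer_graph E p =
    \<lparr>verts = verts E,
     arcs = {(e, i). e \<in> arcs E \<and> 0 \<le> i \<and> i < int (p e)},
     tail = (\<lambda>(e, i). tail E e),
     head = (\<lambda>(e, i). head E e)\<rparr>"

definition integer_bundle :: "'v set \<Rightarrow> ('v, 'v \<times> int) category" where
  "integer_bundle V =
    \<lparr>Obj = V,
     Mor = V \<times> UNIV,
     src = fst,
     rng = fst,
     ident = (\<lambda>v. (v, 0)),
     comp = (\<lambda>(v, a) (w, b). (v, a + b))\<rparr>"

text \<open>
  On representatives \<open>0 \<le> i < p(e)\<close>: \<open>a \<triangleright> (e, i) = (e, (a + i) mod p(e))\<close> with carry
  \<open>a \<triangleleft> (e, i) = \<lfloor>(a + i) / p(e)\<rfloor>\<close> (\<open>div\<close> on \<open>int\<close> is the floor), extended to paths by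
  \<open>g \<triangleright> (f\<xi>) = (g \<triangleright> f)((g \<triangleleft> f) \<triangleright> \<xi>)\<close> and \<open>g \<triangleleft> (f\<xi>) = (g \<triangleleft> f) \<triangleleft> \<xi>\<close>.
\<close>

fun odometer_act :: "('e \<Rightarrow> nat) \<Rightarrow> int \<Rightarrow> ('e \<times> int) list \<Rightarrow> ('e \<times> int) list" where
  "odometer_act p a [] = []"
| "odometer_act p a ((e, i) # \<xi>) =
    (e, (a + i) mod int (p e)) # odometer_act p ((a + i) div int (p e)) \<xi>"

fun odometer_carry :: "('e \<Rightarrow> nat) \<Rightarrow> int \<Rightarrow> ('e \<times> int) list \<Rightarrow> int" where
  "odometer_carry p a [] = a"
| "odometer_carry p a ((e, i) # \<xi>) = odometer_carry p ((a + i) div int (p e)) \<xi>"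

definition odometer_left ::
  "('e \<Rightarrow> nat) \<Rightarrow> 'v \<times> int \<Rightarrow> 'v \<times> ('e \<times> int) list \<Rightarrow> 'v \<times> ('e \<times> int) list" where
  "odometer_left p = (\<lambda>(v, a) (w, \<xi>). (v, odometer_act p a \<xi>))"

definition odometer_right ::
  "('v, 'e) pre_digraph \<Rightarrow> ('e \<Rightarrow> nat) \<Rightarrow> 'v \<times> int \<Rightarrow> 'v \<times> ('e \<times> int) list \<Rightarrow> 'v \<times> int" where
  "odometer_right E p =
    (\<lambda>(v, a) (w, \<xi>). (path_src (odometer_graph E p) (w, \<xi>), odometer_carry p a \<xi>))"

definition odometer_category ::
  "('v, 'e) pre_digraph \<Rightarrow> ('e \<Rightarrow> nat) \<Rightarrow> ('v, ('v \<times> ('e \<times> int) list) \<times> ('v \<times> int)) category" where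
  "odometer_category E p =
    zappa_szep (integer_bundle (verts E)) (path_category (odometer_graph E p))
      (odometer_left p) (odometer_right E p)"

definition odometer_homology ::
  "('v, 'e) pre_digraph \<Rightarrow> ('e \<Rightarrow> nat) \<Rightarrow> nat
    \<Rightarrow> ((('v \<times> ('e \<times> int) list) \<times> ('v \<times> int)) list \<Rightarrow>\<^sub>0 int) set monoid" where
  "odometer_homology E p k = homology (odometer_category E p) k"

definition M_map :: "('v, 'e) pre_digraph \<Rightarrow> ('e \<Rightarrow> nat) \<Rightarrow> ('e \<Rightarrow>\<^sub>0 int) \<Rightarrow> ('v \<Rightarrow>\<^sub>0 int)" where
  "M_map E p =
    frag_extend (\<lambda>e. frag_cmul (int (p e)) (frag_of (head E e)) - frag_of (tail E e))"

definition ker_M :: "('v, 'e) pre_digraph \<Rightarrow> ('e \<Rightarrow> nat) \<Rightarrow> ('e \<Rightarrow>\<^sub>0 int) monoid" where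
  "ker_M E p = (free_Abelian_group (arcs E))
    \<lparr>carrier := kernel (free_Abelian_group (arcs E)) (free_Abelian_group (verts E)) (M_map E p)\<rparr>"

definition coker_M :: "('v, 'e) pre_digraph \<Rightarrow> ('e \<Rightarrow> nat) \<Rightarrow> ('v \<Rightarrow>\<^sub>0 int) set monoid" where
  "coker_M E p =
    free_Abelian_group (verts E) Mod (M_map E p ` carrier (free_Abelian_group (arcs E)))"

text \<open>
  The library's \<open>short_exact_sequence\<close> requires all groups to have the same element type, which is not
  the case here.
\<close>

definition short_exact :: "'a monoid \<Rightarrow> 'b monoid \<Rightarrow> 'c monoid \<Rightarrow> ('a \<Rightarrow> 'b) \<Rightarrow> ('b \<Rightarrow> 'c) \<Rightarrow> bool" where
  "short_exact A B C f g \<longleftrightarrow>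
    group_hom A B f \<and> group_hom B C g \<and> inj_on f (carrier A)
    \<and> f ` carrier A = kernel B C g \<and> g ` carrier B = carrier C"

lemma small_category_integer_bundle: "small_category (integer_bundle V)"
  by unfold_locales (auto simp: integer_bundle_def)

lemma small_category_path_category:
  assumes "wf_digraph E" shows "small_category (path_category E)"
proof -
  interpret wf_digraph E by fact
  have src: "path_src E (v, es) \<in> verts E" if "v \<in> verts E" "set es \<subseteq> arcs E" for v es
    using that by (cases es rule: rev_cases) (auto simp: path_src_def)
  show ?thesis
  proof
    fix e f
    assume e: "e \<in> Mor (path_category E)"
    then show "src (path_category E) e \<in> Obj (path_category E)"
      by (cases e) (simp add: path_category_def src)
    from e show "rng (path_category E) e \<in> Obj (path_category E)"
      "comp (path_category E) (ident (path_category E) (rng (path_category E) e)) e = e"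
      "comp (path_category E) e (ident (path_category E) (src (path_category E) e)) = e"
      by (cases e; simp add: path_category_def)+
    assume f: "f \<in> Mor (path_category E)" and ef: "src (path_category E) e = rng (path_category E) f"
    from e f ef show "comp (path_category E) e f \<in> Mor (path_category E)"
      by (cases e; cases f; cases "snd e = []"; cases "snd f = []")
        (simp_all add: path_category_def path_src_def successively_append_iff)
    from e f ef show "src (path_category E) (comp (path_category E) e f) = src (path_category E) f"
      by (cases e; cases f; cases "snd e = []"; cases "snd f = []")
        (simp_all add: path_category_def path_src_def)
    show "rng (path_category E) (comp (path_category E) e f) = rng (path_category E) e"
      by (cases e; cases f) (simp add: path_category_def)
    fix g
    show "comp (path_category E) (comp (path_category E) e f) g =
        comp (path_category E) e (comp (path_category E) f g)"
      by (cases e; cases f; cases g) (simp add: path_category_def)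
  qed (simp_all add: path_category_def path_src_def)
qed

lemma wf_digraph_odometer_graph:
  assumes "wf_digraph E" shows "wf_digraph (odometer_graph E p)"
proof -
  interpret wf_digraph E by fact
  show ?thesis by unfold_locales (auto simp: odometer_graph_def)
qed

lemma odometer_act_eq_Nil_iff [simp]: "odometer_act p a \<xi> = [] \<longleftrightarrow> \<xi> = []"
  by (cases "(p, a, \<xi>)" rule: odometer_act.cases) auto

lemma map_fst_odometer_act [simp]: "map fst (odometer_act p a \<xi>) = map fst \<xi>"
  by (induction p a \<xi> rule: odometer_act.induct) auto

lemma odometer_act_append:
  "odometer_act p a (\<xi> @ \<eta>) = odometer_act p a \<xi> @ odometer_act p (odometer_carry p a \<xi>) \<eta>"
  by (induction p a \<xi> rule: odometer_act.induct) auto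

lemma odometer_carry_append:
  "odometer_carry p a (\<xi> @ \<eta>) = odometer_carry p (odometer_carry p a \<xi>) \<eta>"
  by (induction p a \<xi> rule: odometer_act.induct) auto

lemma odometer_zero:
  assumes "set \<xi> \<subseteq> arcs (odometer_graph E p)"
  shows "odometer_act p 0 \<xi> = \<xi>" "odometer_carry p 0 \<xi> = 0"
  using assms by (induction \<xi>) (auto simp: odometer_graph_def)

lemma odometer_add:
  assumes pos: "\<forall>e \<in> arcs E. 0 < p e"
  shows "set \<xi> \<subseteq> arcs (odometer_graph E p) \<Longrightarrow>
    odometer_act p (a + b) \<xi> = odometer_act p a (odometer_act p b \<xi>)
    \<and> odometer_carry p (a + b) \<xi> = odometer_carry p a (odometer_act p b \<xi>) + odometer_carry p b \<xi>"
proof (induction \<xi> arbitrary: a b)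
  case (Cons x \<xi>)
  obtain e i where x: "x = (e, i)" by fastforce
  define n where "n = int (p e)"
  define m where "m = (b + i) mod n"
  define q where "q = (b + i) div n"
  from Cons.prems pos x have n: "n \<noteq> 0" by (auto simp: odometer_graph_def n_def)
  have s: "a + b + i = (a + m) + q * n"
    unfolding m_def q_def using div_mult_mod_eq[of "b + i" n] by linarith
  have "(a + b + i) div n = (a + m) div n + q" "(a + b + i) mod n = (a + m) mod n"
    unfolding s using n by simp_all
  moreover have "set \<xi> \<subseteq> arcs (odometer_graph E p)" using Cons.prems by auto
  note IH = Cons.IH[OF this, of "(a + m) div n" q]
  ultimately show ?case
    using IH by (simp add: x n_def[symmetric] m_def[symmetric] q_def[symmetric])
qed auto

lemma odometer_act_arcs:
  assumes "\<forall>e \<in> arcs E. 0 < p e" "set \<xi> \<subseteq> arcs (odometer_graph E p)"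
  shows "set (odometer_act p a \<xi>) \<subseteq> arcs (odometer_graph E p)"
  using assms(2)
proof (induction \<xi> arbitrary: a)
  case (Cons x \<xi>)
  with assms(1) show ?case by (cases x) (auto simp: odometer_graph_def)
qed auto

lemma odometer_path_iff:
  "(v, \<xi>) \<in> Mor (path_category (odometer_graph E p)) \<longleftrightarrow>
    set \<xi> \<subseteq> arcs (odometer_graph E p) \<and> (v, map fst \<xi>) \<in> Mor (path_category E)"
  by (auto simp: path_category_def odometer_graph_def successively_map case_prod_beta hd_map)

lemma odometer_path_src: "path_src (odometer_graph E p) (v, \<xi>) = path_src E (v, map fst \<xi>)"
  by (auto simp: path_src_def odometer_graph_def last_map case_prod_beta)

lemma path_src_append:
  "path_src E (v, es @ fs) = path_src E (path_src E (v, es), fs)"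
  by (auto simp: path_src_def)

lemma path_src_in_verts:
  assumes "wf_digraph E" "\<mu> \<in> Mor (path_category E)" shows "path_src E \<mu> \<in> verts E"
  using small_category.src_in[OF small_category_path_category[OF assms(1)] assms(2)]
  by (simp add: path_category_def)

theorem odometer_matched_pair:
  fixes E :: "('v, 'e) pre_digraph"
  assumes "wf_digraph E" "\<forall>e \<in> arcs E. 0 < p e"
  shows "matched_pair (integer_bundle (verts E)) (path_category (odometer_graph E p))
    (odometer_left p) (odometer_right E p)"
proof -
  let ?G = "integer_bundle (verts E)" and ?F = "odometer_graph E p"
  have sel: "Obj ?G = verts E" "Mor ?G = verts E \<times> UNIV" "src ?G = fst" "rng ?G = fst"
    "ident ?G = (\<lambda>v. (v, 0))" "comp ?G = (\<lambda>(v, a) (w, b). (v, a + b))"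
    "Obj (path_category ?F) = verts E" "src (path_category ?F) = path_src ?F"
    "rng (path_category ?F) = fst" "ident (path_category ?F) = (\<lambda>v. (v, []))"
    "comp (path_category ?F) = (\<lambda>(v, es) (w, fs). (v, es @ fs))"
    by (simp_all add: integer_bundle_def path_category_def odometer_graph_def)
  interpret C: small_category ?G by (rule small_category_integer_bundle)
  interpret D: small_category "path_category ?F"
    by (intro small_category_path_category wf_digraph_odometer_graph assms)
  note act = odometer_act_arcs[OF assms(2)] and add = odometer_add[OF assms(2)]
  note defs = sel odometer_left_def odometer_right_def
  show ?thesis
  proof
    fix c c2 :: "'v \<times> int" and d d2 :: "'v \<times> ('e \<times> int) list"
    obtain v a where c: "c = (v, a)" by fastforce
    obtain w b where c2: "c2 = (w, b)" by fastforce
    obtain x \<xi> where d: "d = (x, \<xi>)" by fastforce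
    obtain y \<eta> where d2: "d2 = (y, \<eta>)" by fastforce
    show "odometer_right E p c (ident (path_category ?F) (src ?G c)) = c"
      by (simp add: c defs path_src_def)
    assume dF: "d \<in> Mor (path_category ?F)"
    then have arcs: "set \<xi> \<subseteq> arcs ?F" and path: "(x, map fst \<xi>) \<in> Mor (path_category E)"
      by (simp_all add: d odometer_path_iff)
    from path have src: "path_src E (x, map fst \<xi>) \<in> verts E" by (rule path_src_in_verts[OF assms(1)])
    show "odometer_left p (ident ?G (rng (path_category ?F) d)) d = d"
      using arcs by (simp add: d defs odometer_zero)
    assume "c \<in> Mor ?G"
    then show "odometer_right E p c d \<in> Mor ?G"
      using src by (simp add: c d defs odometer_path_src)
    show "rng (path_category ?F) (odometer_left p c d) = rng ?G c"
      "src ?G (odometer_right E p c d) = src (path_category ?F) d"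
      by (simp_all add: c d defs)
    { assume "src ?G c = rng (path_category ?F) d"
      then have v: "v = x" by (simp add: c d defs)
      show "odometer_left p c d \<in> Mor (path_category ?F)"
        using path act[OF arcs] by (simp add: c d v defs odometer_path_iff)
      show "src (path_category ?F) (odometer_left p c d) = rng ?G (odometer_right E p c d)"
        by (simp add: c d v defs odometer_path_src)
      assume "src (path_category ?F) d = rng (path_category ?F) d2"
      then have y: "y = path_src ?F (x, \<xi>)" by (simp add: d d2 defs)
      show "odometer_right E p c (comp (path_category ?F) d d2) =
          odometer_right E p (odometer_right E p c d) d2"
        by (simp add: c d d2 y defs odometer_carry_append path_src_append)
      show "odometer_left p c (comp (path_category ?F) d d2) =
          comp (path_category ?F) (odometer_left p c d) (odometer_left p (odometer_right E p c d) d2)"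
        by (simp add: c d d2 y defs odometer_act_append) }
    { assume "src ?G c2 = rng (path_category ?F) d" "src ?G c = rng ?G c2"
      then have "w = x" "v = x" by (simp_all add: c c2 d defs)
      then show "odometer_left p (comp ?G c c2) d = odometer_left p c (odometer_left p c2 d)"
        "odometer_right E p (comp ?G c c2) d =
          comp ?G (odometer_right E p c (odometer_left p c2 d)) (odometer_right E p c2 d)"
        using add[OF arcs] by (simp_all add: c c2 d defs odometer_path_src) }
  qed (simp add: sel)
qed

lemma odometer_generator:
  assumes "(e, i) \<in> arcs (odometer_graph E p)"
  shows "odometer_left p (head E e, 1) (head E e, [(e, i)]) = (head E e, [(e, (i + 1) mod int (p e))])"
    and "odometer_right E p (head E e, 1) (head E e, [(e, i)]) =
      (if i = int (p e) - 1 then (tail E e, 1) else (tail E e, 0))"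
proof -
  have "(1 + i) div int (p e) = (if i = int (p e) - 1 then 1 else 0)"
    using assms by (auto simp: odometer_graph_def)
  then show "odometer_right E p (head E e, 1) (head E e, [(e, i)]) =
      (if i = int (p e) - 1 then (tail E e, 1) else (tail E e, 0))"
    by (simp add: odometer_right_def path_src_def odometer_graph_def)
qed (simp add: odometer_left_def add.commute)

theorem odometer_small_category:
  assumes "wf_digraph E" "\<forall>e \<in> arcs E. 0 < p e"
  shows "small_category (odometer_category E p)"
proof -
  let ?G = "integer_bundle (verts E)" and ?F = "path_category (odometer_graph E p)"
  let ?l = "odometer_left p :: 'a \<times> int \<Rightarrow> _" and ?r = "odometer_right E p"
  interpret matched_pair ?G ?F ?l ?r
    by (rule odometer_matched_pair[OF assms])
  have l_id: "?l c (ident ?F (src ?G c)) = ident ?F (rng ?G c)" for c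
    by (cases c) (simp add: odometer_left_def path_category_def integer_bundle_def)
  have r_id: "?r (ident ?G (rng ?F d)) d = ident ?G (src ?F d)" if "d \<in> Mor ?F" for d
    using that
    by (cases d)
      (simp add: odometer_right_def path_category_def integer_bundle_def odometer_zero(2)[of _ E p])
  have sel: "Obj (odometer_category E p) = Obj ?G"
    "Mor (odometer_category E p) = {(d, c). d \<in> Mor ?F \<and> c \<in> Mor ?G \<and> src ?F d = rng ?G c}"
    "src (odometer_category E p) = (\<lambda>(d, c). src ?G c)"
    "rng (odometer_category E p) = (\<lambda>(d, c). rng ?F d)"
    "ident (odometer_category E p) = (\<lambda>x. (ident ?F x, ident ?G x))"
    "comp (odometer_category E p) =
      (\<lambda>(d1, c1) (d2, c2). (comp ?F d1 (?l c1 d2), comp ?G (?r c1 d2) c2))"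
    by (simp_all add: odometer_category_def zappa_szep_def)
  note C = C.src_in C.rng_in C.ident_in C.src_ident C.rng_ident C.comp_in C.src_comp C.rng_comp
    C.comp_ident_left C.comp_ident_right
  note D = D.src_in D.rng_in D.ident_in D.src_ident D.rng_ident D.comp_in D.src_comp D.rng_comp
    D.comp_ident_left D.comp_ident_right
  note lr = l_in rng_l l_ident r_in src_r r_ident src_l
  show ?thesis
  proof
    fix x assume x: "x \<in> Obj (odometer_category E p)"
    then have "x \<in> Obj ?F" by (simp add: sel Obj_eq)
    with x show "ident (odometer_category E p) x \<in> Mor (odometer_category E p)"
      "src (odometer_category E p) (ident (odometer_category E p) x) = x"
      "rng (odometer_category E p) (ident (odometer_category E p) x) = x"
      by (simp_all add: sel C D)
  next
    fix e assume e: "e \<in> Mor (odometer_category E p)"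
    obtain d c where dc: "e = (d, c)" by (cases e)
    from e have *: "d \<in> Mor ?F" "c \<in> Mor ?G" "src ?F d = rng ?G c" by (simp_all add: sel dc)
    show "src (odometer_category E p) e \<in> Obj (odometer_category E p)"
      using * by (simp add: sel dc C)
    show "rng (odometer_category E p) e \<in> Obj (odometer_category E p)"
      using * by (simp add: sel dc D Obj_eq)
    show "comp (odometer_category E p) (ident (odometer_category E p) (rng (odometer_category E p) e)) e = e"
      using * by (simp add: sel dc C D lr r_id)
    show "comp (odometer_category E p) e (ident (odometer_category E p) (src (odometer_category E p) e)) = e"
      using * D.comp_ident_right[of d] by (simp add: sel dc C lr l_id)
    fix f assume f: "f \<in> Mor (odometer_category E p)"
      and ef: "src (odometer_category E p) e = rng (odometer_category E p) f"
    obtain d' c' where dc': "f = (d', c')" by (cases f)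
    from f ef have **: "d' \<in> Mor ?F" "c' \<in> Mor ?G" "src ?F d' = rng ?G c'" "src ?G c = rng ?F d'"
      by (simp_all add: sel dc dc')
    show "comp (odometer_category E p) e f \<in> Mor (odometer_category E p)"
      "src (odometer_category E p) (comp (odometer_category E p) e f) = src (odometer_category E p) f"
      "rng (odometer_category E p) (comp (odometer_category E p) e f) = rng (odometer_category E p) e"
      using * ** by (simp_all add: sel dc dc' C D lr)
    fix g assume g: "g \<in> Mor (odometer_category E p)"
      and fg: "src (odometer_category E p) f = rng (odometer_category E p) g"
    obtain d'' c'' where dc'': "g = (d'', c'')" by (cases g)
    from g fg have ***: "d'' \<in> Mor ?F" "c'' \<in> Mor ?G" "src ?F d'' = rng ?G c''" "src ?G c' = rng ?F d''"
      by (simp_all add: sel dc' dc'')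
    show "comp (odometer_category E p) (comp (odometer_category E p) e f) g =
        comp (odometer_category E p) e (comp (odometer_category E p) f g)"
      using * ** ***
      by (simp add: sel dc dc' dc'' C D lr l_comp l_comp_right r_comp r_comp_left
          C.comp_assoc D.comp_assoc)
  qed
qed

end

(* Writing t for the generator of the copy of Z at each vertex and e for the arc (e, 0), the odometer
   category is presented by the invertible t and the arcs e, subject to t^p(e) e = e t.  So it behaves
   like the complex with one loop per vertex, one edge per arc and one 2-cell per arc, whose 2-cells
   have boundary p(e) [t at r(e)] - [t at s(e)] = M(e).

   A carry q in t^a (e, i) = (e, i') t^q uses the relation of e exactly q times.  Counting these uses
   gives a map from 2-chains to ZE^1, and counting the t in normal forms gives a map from 1-chains to
   ZE^0 which turns the bar differential into M.  A 2-cycle on which the first map vanishes is a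
   boundary, because the universal 2-cocycle is cohomologous to one that only sees carries.  In
   degrees 0 and 1 one compares with E^* along the functors that forget the digits and that set all
   digits to 0: up to a boundary, every 1-chain is the sum of its image under their composite and a
   chain of loops t. *)

theory Submission
  imports Defs
begin

section \<open>Quotients of additive groups\<close>

locale additive_subgroup =
  fixes B :: "'a::ab_group_add set"
  assumes zero: "0 \<in> B" and diff: "\<lbrakk>x \<in> B; y \<in> B\<rbrakk> \<Longrightarrow> x - y \<in> B"
begin

lemma minus: "x \<in> B \<Longrightarrow> - x \<in> B"
  using diff[OF zero] by simp

lemma add: "\<lbrakk>x \<in> B; y \<in> B\<rbrakk> \<Longrightarrow> x + y \<in> B"
  using diff[OF _ minus] by simp

lemma mem_iff: "x - y \<in> B \<Longrightarrow> x \<in> B \<longleftrightarrow> y \<in> B"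
  using add[of "x - y" y] diff[of x "x - y"] by auto

end

text \<open>The chain groups have \<open>+\<close> and \<open>0\<close> of the ambient type as
  operations. Cycles, boundaries, \<open>ker_M\<close> and \<open>coker_M\<close> can therefore all
  be described by plain sets, and equality of cosets becomes membership of a difference.\<close>

definition additive_group :: "'a::ab_group_add set \<Rightarrow> 'a monoid" where
  "additive_group Z = \<lparr>carrier = Z, monoid.mult = (+), one = 0\<rparr>"

lemma additive_group_simps [simp]:
  "carrier (additive_group Z) = Z" "x \<otimes>\<^bsub>additive_group Z\<^esub> y = x + y" "\<one>\<^bsub>additive_group Z\<^esub> = 0"
  by (simp_all add: additive_group_def)

context additive_subgroup
begin

lemma comm_group_additive_group: "comm_group (additive_group B)"
proof (rule comm_groupI)
  fix x assume "x \<in> carrier (additive_group B)"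
  then show "\<exists>y \<in> carrier (additive_group B). y \<otimes>\<^bsub>additive_group B\<^esub> x = \<one>\<^bsub>additive_group B\<^esub>"
    by (intro bexI[of _ "- x"]) (auto simp: minus)
qed (auto simp: zero add ac_simps)

lemma inv_additive_group: "x \<in> B \<Longrightarrow> inv\<^bsub>additive_group B\<^esub> x = - x"
  by (rule group.inv_equality[OF comm_group.axioms(2)[OF comm_group_additive_group]])
    (auto simp: minus)

lemma normal_additive_group:
  assumes "additive_subgroup Z" "B \<subseteq> Z"
  shows "B \<lhd> additive_group Z"
proof -
  interpret Z: additive_subgroup Z by fact
  interpret comm_group "additive_group Z" by (rule Z.comm_group_additive_group)
  have "subgroup B (additive_group Z)"
    using assms(2) by unfold_locales (auto simp: add zero minus Z.inv_additive_group subset_iff)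
  then show ?thesis by (simp add: normal_iff_subgroup)
qed

lemma rcoset_eq_iff:
  "B #>\<^bsub>additive_group Z\<^esub> x = B #>\<^bsub>additive_group Z\<^esub> y \<longleftrightarrow> x - y \<in> B"
proof
  assume "B #>\<^bsub>additive_group Z\<^esub> x = B #>\<^bsub>additive_group Z\<^esub> y"
  moreover have "x \<in> B #>\<^bsub>additive_group Z\<^esub> x" using zero by (force simp: r_coset_def)
  ultimately show "x - y \<in> B" by (auto simp: r_coset_def)
next
  have sub: "B #>\<^bsub>additive_group Z\<^esub> x \<subseteq> B #>\<^bsub>additive_group Z\<^esub> y" if "x - y \<in> B" for x y
  proof
    fix z assume "z \<in> B #>\<^bsub>additive_group Z\<^esub> x"
    then obtain b where b: "b \<in> B" "z = b + x" by (auto simp: r_coset_def)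
    then have "z = (b + (x - y)) + y" "b + (x - y) \<in> B" using add[OF b(1) that] by simp_all
    then show "z \<in> B #>\<^bsub>additive_group Z\<^esub> y" unfolding r_coset_def additive_group_simps by blast
  qed
  assume xy: "x - y \<in> B"
  from minus[OF xy] have "y - x \<in> B" by simp
  from sub[OF xy] sub[OF this] show "B #>\<^bsub>additive_group Z\<^esub> x = B #>\<^bsub>additive_group Z\<^esub> y"
    by (rule equalityI)
qed

lemma rcoset_eq_self_iff: "B #>\<^bsub>additive_group Z\<^esub> x = B \<longleftrightarrow> x \<in> B"
  using rcoset_eq_iff[of Z x 0] by (simp add: r_coset_def)

lemma group_quotient:
  assumes "additive_subgroup Z" "B \<subseteq> Z"
  shows "group (additive_group Z Mod B)"
  by (rule normal.factorgroup_is_group[OF normal_additive_group[OF assms]])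

lemma rcoset_hom_quotient:
  assumes "additive_subgroup Z" "B \<subseteq> Z"
  shows "(\<lambda>x. B #>\<^bsub>additive_group Z\<^esub> x) \<in> hom (additive_group Z) (additive_group Z Mod B)"
  by (rule normal.r_coset_hom_Mod[OF normal_additive_group[OF assms]])

end

text \<open>First isomorphism theorem. Leaving \<open>H\<close> arbitrary covers both a target that
  is itself a quotient (degree 0) and one that is a subgroup (degree 2).\<close>

lemma hom_quotient_iso:
  assumes Z: "additive_subgroup Z" and "group H" and u: "u \<in> hom (additive_group Z) H"
    and onto: "u ` Z = carrier H" and ker: "\<And>x. x \<in> Z \<Longrightarrow> u x = \<one>\<^bsub>H\<^esub> \<longleftrightarrow> x \<in> B" and "B \<subseteq> Z"
  shows "additive_group Z Mod B \<cong> H"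
proof -
  interpret group_hom "additive_group Z" H u
    using assms additive_subgroup.comm_group_additive_group[OF Z]
    by (simp add: group_hom_def group_hom_axioms_def comm_group.axioms(2))
  have "kernel (additive_group Z) H u = B"
    using ker \<open>B \<subseteq> Z\<close> by (auto simp: kernel_def)
  with FactGroup_iso onto show ?thesis by simp
qed

text \<open>The map \<open>u\<close> followed by the projection to cosets of \<open>B'\<close> is
  onto and has kernel \<open>B\<close>.\<close>

lemma additive_quotient_iso:
  assumes Z: "additive_subgroup Z" "B \<subseteq> Z"
    and Z': "additive_subgroup Z'" "additive_subgroup B'" "B' \<subseteq> Z'"
    and add: "\<And>x y. u (x + y) = u x + u y"
    and onto: "u ` Z = Z'" and ker: "\<And>x. x \<in> Z \<Longrightarrow> u x \<in> B' \<longleftrightarrow> x \<in> B"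
  shows "additive_group Z Mod B \<cong> additive_group Z' Mod B'"
proof (rule hom_quotient_iso[OF Z(1) _ _ _ _ Z(2)])
  interpret B': additive_subgroup B' by fact
  let ?q = "\<lambda>x. B' #>\<^bsub>additive_group Z'\<^esub> x"
  show "group (additive_group Z' Mod B')" by (rule B'.group_quotient[OF Z'(1,3)])
  have "u \<in> hom (additive_group Z) (additive_group Z')" using onto add by (auto simp: hom_def)
  from hom_compose[OF this B'.rcoset_hom_quotient[OF Z'(1,3)]]
  show "?q \<circ> u \<in> hom (additive_group Z) (additive_group Z' Mod B')" .
  show "(?q \<circ> u) ` Z = carrier (additive_group Z' Mod B')"
    unfolding image_comp[symmetric] onto by (simp add: carrier_FactGroup)
  show "(?q \<circ> u) x = \<one>\<^bsub>additive_group Z' Mod B'\<^esub> \<longleftrightarrow> x \<in> B" if "x \<in> Z" for x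
    using ker[OF that] by (simp add: B'.rcoset_eq_self_iff)
qed

lemma additive_quotient_iso_image:
  assumes "additive_subgroup Z" "B \<subseteq> Z" "additive_subgroup K"
    and "\<And>x y. u (x + y) = u x + u y"
    and "u ` Z = K" and "\<And>x. x \<in> Z \<Longrightarrow> u x = 0 \<longleftrightarrow> x \<in> B"
  shows "additive_group Z Mod B \<cong> additive_group K"
proof (rule hom_quotient_iso[OF assms(1) _ _ _ _ assms(2)])
  show "group (additive_group K)"
    using additive_subgroup.comm_group_additive_group[OF assms(3)] by (rule comm_group.axioms)
qed (use assms in \<open>auto simp: hom_def\<close>)

lemma additive_quotient_map:
  assumes Z: "additive_subgroup Z" "additive_subgroup B" "B \<subseteq> Z"
    and Z': "additive_subgroup Z'" "additive_subgroup B'" "B' \<subseteq> Z'"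
    and add: "\<And>x y. u (x + y) = u x + u y"
    and uZ: "u ` Z \<subseteq> Z'" and uB: "u ` B \<subseteq> B'"
  obtains h where "group_hom (additive_group Z Mod B) (additive_group Z' Mod B') h"
    "\<And>x. x \<in> Z \<Longrightarrow> h (B #>\<^bsub>additive_group Z\<^esub> x) = B' #>\<^bsub>additive_group Z'\<^esub> u x"
proof -
  interpret B: additive_subgroup B by fact
  interpret B': additive_subgroup B' by fact
  let ?q = "\<lambda>x. B' #>\<^bsub>additive_group Z'\<^esub> x"
  have diff: "u (x - y) = u x - u y" for x y
    using add[of "x - y" y] by (simp add: algebra_simps)
  have "u \<in> hom (additive_group Z) (additive_group Z')" using uZ add by (auto simp: hom_def)
  from hom_compose[OF this B'.rcoset_hom_quotient[OF Z'(1,3)]]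
  have hom: "?q \<circ> u \<in> hom (additive_group Z) (additive_group Z' Mod B')" .
  have cong: "(?q \<circ> u) x = (?q \<circ> u) y"
    if "B #>\<^bsub>additive_group Z\<^esub> x = B #>\<^bsub>additive_group Z\<^esub> y" for x y
    using that uB by (auto simp: B.rcoset_eq_iff B'.rcoset_eq_iff diff[symmetric])
  obtain h where "h \<in> hom (additive_group Z Mod B) (additive_group Z' Mod B')"
    "\<And>x. x \<in> carrier (additive_group Z) \<Longrightarrow> h (B #>\<^bsub>additive_group Z\<^esub> x) = (?q \<circ> u) x"
    using FactGroup_universal[OF hom B.normal_additive_group[OF Z(1,3)] cong] by blast
  then show ?thesis
    using that B.group_quotient[OF Z(1,3)] B'.group_quotient[OF Z'(1,3)]
    by (simp add: group_hom_def group_hom_axioms_def)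
qed

text \<open>Exactness is tested on representatives. The equivalence \<open>inj\<close> makes the
  first map both well defined and injective, while \<open>zero\<close> and \<open>exact\<close> are
  the two inclusions at the middle group.\<close>

lemma short_exact_additive_quotients:
  assumes Z1: "additive_subgroup Z1" "additive_subgroup B1" "B1 \<subseteq> Z1"
    and Z2: "additive_subgroup Z2" "additive_subgroup B2" "B2 \<subseteq> Z2"
    and Z3: "additive_subgroup Z3" "additive_subgroup B3" "B3 \<subseteq> Z3"
    and u: "\<And>x y. u (x + y) = u x + u y" "u ` Z1 \<subseteq> Z2"
    and w: "\<And>x y. w (x + y) = w x + w y" "w ` Z2 = Z3" "w ` B2 \<subseteq> B3"
    and inj: "\<And>x. x \<in> Z1 \<Longrightarrow> u x \<in> B2 \<longleftrightarrow> x \<in> B1"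
    and zero: "\<And>x. x \<in> Z1 \<Longrightarrow> w (u x) \<in> B3"
    and exact: "\<And>y. \<lbrakk>y \<in> Z2; w y \<in> B3\<rbrakk> \<Longrightarrow> \<exists>x \<in> Z1. y - u x \<in> B2"
  shows "\<exists>f g. short_exact (additive_group Z1 Mod B1) (additive_group Z2 Mod B2)
    (additive_group Z3 Mod B3) f g"
proof -
  interpret Z1: additive_subgroup Z1 by fact
  interpret B1: additive_subgroup B1 by fact
  interpret B2: additive_subgroup B2 by fact
  interpret B3: additive_subgroup B3 by fact
  let ?q1 = "\<lambda>x. B1 #>\<^bsub>additive_group Z1\<^esub> x" and ?q2 = "\<lambda>x. B2 #>\<^bsub>additive_group Z2\<^esub> x"
    and ?q3 = "\<lambda>x. B3 #>\<^bsub>additive_group Z3\<^esub> x"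
  have "u ` B1 \<subseteq> B2" using inj Z1(3) by auto
  from additive_quotient_map[where u = u, OF Z1 Z2 u this] obtain f where
    f: "group_hom (additive_group Z1 Mod B1) (additive_group Z2 Mod B2) f"
      "\<And>x. x \<in> Z1 \<Longrightarrow> f (?q1 x) = ?q2 (u x)" by blast
  from additive_quotient_map[where u = w, OF Z2 Z3 w(1) equalityD1[OF w(2)] w(3)] obtain g where
    g: "group_hom (additive_group Z2 Mod B2) (additive_group Z3 Mod B3) g"
      "\<And>y. y \<in> Z2 \<Longrightarrow> g (?q2 y) = ?q3 (w y)" by blast
  have udiff: "u (x - y) = u x - u y" for x y
    using u(1)[of "x - y" y] by (simp add: algebra_simps)
  have "inj_on f (carrier (additive_group Z1 Mod B1))"
  proof (rule inj_onI)
    fix X Y assume "X \<in> carrier (additive_group Z1 Mod B1)" "Y \<in> carrier (additive_group Z1 Mod B1)"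
      and eq: "f X = f Y"
    then obtain x y where xy: "x \<in> Z1" "y \<in> Z1" "X = ?q1 x" "Y = ?q1 y"
      by (auto simp: carrier_FactGroup)
    with eq have "u (x - y) \<in> B2" by (simp add: f B2.rcoset_eq_iff udiff)
    with inj[OF Z1.diff[OF xy(1,2)]] show "X = Y" by (simp add: xy B1.rcoset_eq_iff)
  qed
  moreover have "f ` carrier (additive_group Z1 Mod B1) =
      kernel (additive_group Z2 Mod B2) (additive_group Z3 Mod B3) g" (is "?L = ?R")
  proof (intro equalityI subsetI)
    fix Y assume "Y \<in> ?L"
    then obtain x where x: "x \<in> Z1" "Y = ?q2 (u x)" by (auto simp: carrier_FactGroup f(2))
    then have "u x \<in> Z2" using u(2) by blast
    with zero[OF x(1)] show "Y \<in> ?R"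
      by (simp add: kernel_def carrier_FactGroup g(2) x(2) B3.rcoset_eq_self_iff)
  next
    fix Y assume "Y \<in> ?R"
    then obtain y where y: "y \<in> Z2" "Y = ?q2 y" and "g (?q2 y) = B3"
      by (auto simp: carrier_FactGroup kernel_def)
    then have "w y \<in> B3" by (simp add: g(2) B3.rcoset_eq_self_iff)
    from exact[OF y(1) this] obtain x where "x \<in> Z1" "y - u x \<in> B2" by blast
    then have "Y = f (?q1 x)" by (simp add: y f B2.rcoset_eq_iff)
    with \<open>x \<in> Z1\<close> show "Y \<in> ?L" by (simp add: carrier_FactGroup)
  qed
  moreover have "g ` ?q2 ` Z2 = ?q3 ` w ` Z2"
    unfolding image_image by (rule image_cong) (simp_all add: g(2))
  then have "g ` carrier (additive_group Z2 Mod B2) = carrier (additive_group Z3 Mod B3)"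
    by (simp only: carrier_FactGroup additive_group_simps w(2))
  ultimately show ?thesis using f(1) g(1) unfolding short_exact_def by blast
qed

section \<open>Subgroups of free abelian groups and linear extension\<close>

lemma additive_subgroup_keys: "additive_subgroup {z :: 'a \<Rightarrow>\<^sub>0 int. Poly_Mapping.keys z \<subseteq> S}"
  by unfold_locales (use keys_diff in fastforce)+

lemma additive_subgroup_image:
  fixes u :: "'a::ab_group_add \<Rightarrow> 'b::ab_group_add"
  assumes "additive_subgroup Z" and u: "\<And>x y. u (x - y) = u x - u y"
  shows "additive_subgroup (u ` Z)"
proof
  interpret additive_subgroup Z by fact
  show "0 \<in> u ` Z" using u[of 0 0, unfolded diff_self] zero by force
  show "x - y \<in> u ` Z" if "x \<in> u ` Z" "y \<in> u ` Z" for x y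
    using that by (auto simp: u[symmetric] diff)
qed

lemma additive_subgroup_ker:
  fixes u :: "'a::ab_group_add \<Rightarrow> 'b::ab_group_add"
  assumes "additive_subgroup Z" and u: "\<And>x y. u (x - y) = u x - u y"
  shows "additive_subgroup {z \<in> Z. u z = 0}"
proof
  interpret additive_subgroup Z by fact
  show "0 \<in> {z \<in> Z. u z = 0}" using u[of 0 0, unfolded diff_self] zero by simp
qed (use assms in \<open>auto simp: additive_subgroup.diff\<close>)

lemma frag_cmul_diff_distrib2: "frag_cmul c (a - b) = frag_cmul c a - frag_cmul c b"
  by (rule poly_mapping_eqI) (simp add: lookup_minus right_diff_distrib)

lemma frag_cmul_mem:
  assumes "additive_subgroup B" "x \<in> B" shows "frag_cmul n x \<in> B"
  using assms frag_closure_minus_cmul[of "\<lambda>x. x \<in> B"]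
  by (auto simp: additive_subgroup.zero additive_subgroup.diff)

lemma frag_extend_mem:
  assumes "additive_subgroup Z" "Poly_Mapping.keys z \<subseteq> S" "\<And>x. x \<in> S \<Longrightarrow> f x \<in> Z"
  shows "frag_extend f z \<in> Z"
  using assms(2)
  by (induction z rule: frag_induction)
    (auto simp: frag_extend_diff assms additive_subgroup.zero additive_subgroup.diff)

text \<open>Since the shift is an equivalence, one step serves the induction upwards and downwards
  from \<open>k\<close>.\<close>

lemma int_shift_invariant:
  fixes P :: "int \<Rightarrow> bool"
  assumes "\<And>n. P (n + 1) \<longleftrightarrow> P n" and "P k" shows "P n"
proof (induction n rule: int_induct[where k = k])
  case (step2 i)
  then show ?case using assms(1)[of "i - 1"] by simp
qed (use assms in auto)

text \<open>Modulo \<open>B\<close> the map \<open>f\<close> is a homomorphism from the integers,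
  hence determined by its value at 1. Degree 1 applies this to powers of \<open>t\<close>, degree 2
  to exponents that are multiples of \<open>p(e)\<close>.\<close>

lemma additive_mod_int:
  fixes f :: "int \<Rightarrow> 'a \<Rightarrow>\<^sub>0 int"
  assumes "additive_subgroup B" and f: "\<And>a b. f (a + b) - f a - f b \<in> B"
  shows "f n - frag_cmul n (f 1) \<in> B"
proof (rule int_shift_invariant[of "\<lambda>n. f n - frag_cmul n (f 1) \<in> B" 0])
  interpret additive_subgroup B by fact
  show "f 0 - frag_cmul 0 (f 1) \<in> B" using minus[OF f[of 0 0]] by simp
  show "f (n + 1) - frag_cmul (n + 1) (f 1) \<in> B \<longleftrightarrow> f n - frag_cmul n (f 1) \<in> B" for n
    using f[of n 1] by (intro mem_iff) (simp add: frag_cmul_distrib algebra_simps)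
qed

section \<open>Chains and homology in low degrees\<close>

definition boundaries :: "('o, 'm) category \<Rightarrow> nat \<Rightarrow> ('m list \<Rightarrow>\<^sub>0 int) set" where
  "boundaries C k = boundary C k ` {z. Poly_Mapping.keys z \<subseteq> nerve C (Suc k)}"

lemma homology_eq: "homology C k = additive_group (cycles C k) Mod boundaries C k"
proof -
  have "carrier (chains C (Suc k)) = {z. Poly_Mapping.keys z \<subseteq> nerve C (Suc k)}"
    by (auto simp: chains_def)
  then show ?thesis
    by (simp add: homology_def boundaries_def)
      (simp add: chains_def free_Abelian_group_def additive_group_def)
qed

lemma cycles_0: "cycles C 0 = {z. Poly_Mapping.keys z \<subseteq> nerve C 0}"
  by (auto simp: chains_def)

lemma cycles_Suc: "cycles C (Suc k) = {z \<in> {z. Poly_Mapping.keys z \<subseteq> nerve C (Suc k)}. boundary C k z = 0}"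
  by (auto simp: chains_def kernel_def)

declare cycles.simps [simp del]

lemma boundary_diff: "boundary C k (x - y) = boundary C k x - boundary C k y"
  by (simp add: boundary_def frag_extend_diff)

lemma boundary_of [simp]: "boundary C k (frag_of es) = boundary_simplex C k es"
  by (simp add: boundary_def)

lemma additive_subgroup_cycles: "additive_subgroup (cycles C k)"
  by (cases k)
    (simp_all only: cycles_0 cycles_Suc additive_subgroup_ker additive_subgroup_keys boundary_diff)

lemma additive_subgroup_boundaries: "additive_subgroup (boundaries C k)"
  unfolding boundaries_def
  by (intro additive_subgroup_image additive_subgroup_keys boundary_diff)

text \<open>Cycles form a subgroup, so that two successive boundary maps compose to zero has to be
  checked on basis tuples only.\<close>

lemma boundaries_subset_cyclesI:
  assumes "\<And>es. es \<in> nerve C (Suc k) \<Longrightarrow> boundary_simplex C k es \<in> cycles C k"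
  shows "boundaries C k \<subseteq> cycles C k"
  using assms unfolding boundaries_def
  by (auto simp: boundary_def intro!: frag_extend_mem[OF additive_subgroup_cycles])

lemma boundary_simplex_in_boundaries:
  "es \<in> nerve C (Suc k) \<Longrightarrow> boundary_simplex C k es \<in> boundaries C k"
  unfolding boundaries_def by (rule image_eqI[of _ _ "frag_of es"]) auto

lemma nerve_Suc_0: "nerve C (Suc 0) = {[e] |e. e \<in> Mor C}"
  by (auto simp: nerve_def length_Suc_conv)

lemma nerve_2: "nerve C (Suc (Suc 0)) = {[e, f] |e f. e \<in> Mor C \<and> f \<in> Mor C \<and> src C e = rng C f}"
  by (auto simp: nerve_def length_Suc_conv)

lemma nerve_3: "nerve C (Suc (Suc (Suc 0))) = {[e, f, g] |e f g. e \<in> Mor C \<and> f \<in> Mor C \<and> g \<in> Mor C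
    \<and> src C e = rng C f \<and> src C f = rng C g}"
  by (auto simp: nerve_def length_Suc_conv)

lemma nerve_1I: "e \<in> Mor C \<Longrightarrow> [e] \<in> nerve C (Suc 0)"
  by (simp add: nerve_Suc_0)

lemma nerve_2I: "\<lbrakk>e \<in> Mor C; f \<in> Mor C; src C e = rng C f\<rbrakk> \<Longrightarrow> [e, f] \<in> nerve C (Suc (Suc 0))"
  unfolding nerve_2 by blast

lemma nerve_3I: "\<lbrakk>e \<in> Mor C; f \<in> Mor C; g \<in> Mor C; src C e = rng C f; src C f = rng C g\<rbrakk>
    \<Longrightarrow> [e, f, g] \<in> nerve C (Suc (Suc (Suc 0)))"
  unfolding nerve_3 by blast

lemma boundary_simplex_0: "boundary_simplex C 0 [e] = frag_of [ident C (src C e)] - frag_of [ident C (rng C e)]"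
  by (simp add: boundary_simplex_def)

lemma boundary_simplex_1:
  "boundary_simplex C (Suc 0) [e, f] = frag_of [f] - frag_of [comp C e f] + frag_of [e]"
  by (simp add: boundary_simplex_def merge_def)

lemma boundary_simplex_2:
  "boundary_simplex C (Suc (Suc 0)) [e, f, g] =
    frag_of [f, g] - frag_of [comp C e f, g] + frag_of [e, comp C f g] - frag_of [e, f]"
proof -
  have "{1..Suc (Suc 0)} = {1, 2}" by auto
  then show ?thesis by (simp add: boundary_simplex_def merge_def)
qed

section \<open>Boundaries are cycles in degrees 0 to 2\<close>

context small_category
begin

lemma boundaries_0_subset_cycles: "boundaries C 0 \<subseteq> cycles C 0"
proof (rule boundaries_subset_cyclesI)
  fix es assume "es \<in> nerve C (Suc 0)"
  then obtain e where e: "e \<in> Mor C" "es = [e]" by (auto simp: nerve_Suc_0)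
  have "frag_of [ident C x] \<in> cycles C 0" if "x \<in> Obj C" for x
    using that by (auto simp: cycles_0 nerve_def)
  then show "boundary_simplex C 0 es \<in> cycles C 0"
    by (simp add: e boundary_simplex_0 additive_subgroup.diff[OF additive_subgroup_cycles] src_in rng_in)
qed

lemma boundaries_1_subset_cycles: "boundaries C (Suc 0) \<subseteq> cycles C (Suc 0)"
proof (rule boundaries_subset_cyclesI)
  fix es assume "es \<in> nerve C (Suc (Suc 0))"
  then obtain e f where e: "e \<in> Mor C" "f \<in> Mor C" "src C e = rng C f" "es = [e, f]"
    by (auto simp: nerve_2)
  let ?K = "{z :: _ \<Rightarrow>\<^sub>0 int. Poly_Mapping.keys z \<subseteq> nerve C (Suc 0)}"
  interpret K: additive_subgroup ?K by (rule additive_subgroup_keys)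
  have "frag_of [x] \<in> ?K" if "x \<in> Mor C" for x using that by (simp add: nerve_Suc_0)
  with e have "boundary_simplex C (Suc 0) es \<in> ?K"
    unfolding e(4) boundary_simplex_1 by (intro K.add K.diff) (simp_all add: comp_in)
  then show "boundary_simplex C (Suc 0) es \<in> cycles C (Suc 0)"
    using e by (simp add: cycles_Suc boundary_simplex_1 boundary_def frag_extend_add frag_extend_diff
        boundary_simplex_0 src_comp rng_comp)
qed

text \<open>The twelve terms of the iterated boundary cancel in pairs; the two bracketings of the
  triple composite agree by \<open>comp_assoc\<close>.\<close>

lemma boundaries_2_subset_cycles: "boundaries C (Suc (Suc 0)) \<subseteq> cycles C (Suc (Suc 0))"
proof (rule boundaries_subset_cyclesI)
  fix es assume "es \<in> nerve C (Suc (Suc (Suc 0)))"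
  then obtain e f g where e: "e \<in> Mor C" "f \<in> Mor C" "g \<in> Mor C" "src C e = rng C f"
      "src C f = rng C g" "es = [e, f, g]"
    by (auto simp: nerve_3)
  let ?K = "{z :: _ \<Rightarrow>\<^sub>0 int. Poly_Mapping.keys z \<subseteq> nerve C (Suc (Suc 0))}"
  interpret K: additive_subgroup ?K by (rule additive_subgroup_keys)
  have "frag_of [x, y] \<in> ?K" if "x \<in> Mor C" "y \<in> Mor C" "src C x = rng C y" for x y
    using that by (simp add: nerve_2)
  with e have "boundary_simplex C (Suc (Suc 0)) es \<in> ?K"
    unfolding e(6) boundary_simplex_2 by (intro K.add K.diff) (simp_all add: comp_in src_comp rng_comp)
  then show "boundary_simplex C (Suc (Suc 0)) es \<in> cycles C (Suc (Suc 0))"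
    using e by (simp add: cycles_Suc boundary_simplex_2 boundary_def frag_extend_add frag_extend_diff
        boundary_simplex_1 comp_assoc)
qed

end

section \<open>Chain maps induced by functors\<close>

definition chain_map :: "('m \<Rightarrow> 'n) \<Rightarrow> ('m list \<Rightarrow>\<^sub>0 int) \<Rightarrow> ('n list \<Rightarrow>\<^sub>0 int)" where
  "chain_map F = frag_extend (\<lambda>es. frag_of (map F es))"

lemma chain_map_of [simp]: "chain_map F (frag_of es) = frag_of (map F es)"
  by (simp add: chain_map_def)

lemma chain_map_diff: "chain_map F (x - y) = chain_map F x - chain_map F y"
  by (simp add: chain_map_def frag_extend_diff)

lemma chain_map_add: "chain_map F (x + y) = chain_map F x + chain_map F y"
  by (simp add: chain_map_def frag_extend_add)

locale category_functor = C: small_category C + D: small_category D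
  for C :: "('o, 'm) category" and D :: "('o2, 'n) category" +
  fixes Fo :: "'o \<Rightarrow> 'o2" and F :: "'m \<Rightarrow> 'n"
  assumes Fo_in: "x \<in> Obj C \<Longrightarrow> Fo x \<in> Obj D"
    and F_in: "e \<in> Mor C \<Longrightarrow> F e \<in> Mor D"
    and F_src: "e \<in> Mor C \<Longrightarrow> src D (F e) = Fo (src C e)"
    and F_rng: "e \<in> Mor C \<Longrightarrow> rng D (F e) = Fo (rng C e)"
    and F_ident: "x \<in> Obj C \<Longrightarrow> F (ident C x) = ident D (Fo x)"
    and F_comp: "\<lbrakk>e \<in> Mor C; f \<in> Mor C; src C e = rng C f\<rbrakk> \<Longrightarrow> F (comp C e f) = comp D (F e) (F f)"
begin

lemma map_nerve:
  assumes "es \<in> nerve C k" shows "map F es \<in> nerve D k"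
proof (cases "k = 0")
  case True
  with assms show ?thesis by (auto simp: nerve_def F_ident Fo_in)
next
  case False
  with assms have es: "length es = k" "set es \<subseteq> Mor C" "successively (\<lambda>e f. src C e = rng C f) es"
    by (auto simp: nerve_def)
  have "successively (\<lambda>e f. src D (F e) = rng D (F f)) es"
    using es(3) by (rule successively_mono) (use es(2) in \<open>simp add: subset_iff F_src F_rng\<close>)
  with es False show ?thesis by (auto simp: nerve_def successively_map F_in)
qed

lemma map_merge:
  assumes "es \<in> nerve C (Suc k)" "i \<in> {1..k}"
  shows "map F (merge C i es) = merge D i (map F es)"
proof -
  from assms(1) have es: "length es = Suc k" "set es \<subseteq> Mor C"
    "successively (\<lambda>e f. src C e = rng C f) es"
    by (auto simp: nerve_def)
  \<comment> \<open>Because \<open>1 <= i\<close>, the truncated difference \<open>i - 1\<close> is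
    a true predecessor, so the merged entries are neighbours and composable.\<close>
  from assms(2) have i: "Suc (i - 1) = i" "i - 1 < length es" "i < length es" using es(1) by auto
  then have "es ! (i - 1) \<in> Mor C" "es ! i \<in> Mor C" "src C (es ! (i - 1)) = rng C (es ! i)"
    using es(2,3) by (auto simp: successively_conv_nth)
  with i show ?thesis by (simp add: merge_def F_comp take_map drop_map)
qed

lemma boundary_simplex_map:
  assumes "es \<in> nerve C (Suc k)"
  shows "boundary_simplex D k (map F es) = chain_map F (boundary_simplex C k es)"
proof (cases "k = 0")
  case True
  with assms obtain e where "e \<in> Mor C" "es = [e]" by (auto simp: nerve_Suc_0)
  with True show ?thesis
    by (simp add: boundary_simplex_0 chain_map_diff F_ident F_src F_rng C.src_in C.rng_in)
next
  case False
  have "es \<noteq> []" using assms by (auto simp: nerve_def)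
  with False show ?thesis
    using map_merge[OF assms]
    by (simp add: boundary_simplex_def chain_map_def frag_extend_add frag_extend_sum frag_extend_cmul
        o_def map_tl map_butlast)
qed

lemma boundary_chain_map:
  assumes "Poly_Mapping.keys z \<subseteq> nerve C (Suc k)"
  shows "boundary D k (chain_map F z) = chain_map F (boundary C k z)"
  using assms
  by (induction z rule: frag_induction)
    (auto simp: boundary_simplex_map boundary_diff chain_map_diff, simp_all add: chain_map_def boundary_def)

lemma keys_chain_map:
  assumes "Poly_Mapping.keys z \<subseteq> nerve C k" shows "Poly_Mapping.keys (chain_map F z) \<subseteq> nerve D k"
  using frag_extend_mem[OF additive_subgroup_keys assms, of "\<lambda>es. frag_of (map F es)" "nerve D k"] map_nerve
  by (simp add: chain_map_def)

lemma chain_map_cycles: "z \<in> cycles C k \<Longrightarrow> chain_map F z \<in> cycles D k"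
  by (cases k)
    (auto simp: cycles_0 cycles_Suc boundary_chain_map dest: keys_chain_map, simp add: chain_map_def)

lemma chain_map_boundaries: "z \<in> boundaries C k \<Longrightarrow> chain_map F z \<in> boundaries D k"
  unfolding boundaries_def using keys_chain_map by (auto simp: boundary_chain_map[symmetric])

end

section \<open>The odometer category\<close>

text \<open>
  \<open>weight\<close> and \<open>turns\<close> count the generators \<open>t\<close> and the relations \<open>t\<^sup>p e = e t\<close> used when a path is
  brought to normal form, respectively moved past \<open>t\<^sup>a\<close>.
\<close>

fun weight :: "('v, 'e) pre_digraph \<Rightarrow> ('e \<times> int) list \<Rightarrow> 'v \<Rightarrow>\<^sub>0 int" where
  "weight E [] = 0"
| "weight E ((e, i) # \<xi>) = frag_cmul i (frag_of (head E e)) + weight E \<xi>"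

fun turns :: "('e \<Rightarrow> nat) \<Rightarrow> int \<Rightarrow> ('e \<times> int) list \<Rightarrow> 'e \<Rightarrow>\<^sub>0 int" where
  "turns p a [] = 0"
| "turns p a ((e, i) # \<xi>) =
    frag_cmul ((a + i) div int (p e)) (frag_of e) + turns p ((a + i) div int (p e)) \<xi>"

lemma weight_append: "weight E (\<xi> @ \<eta>) = weight E \<xi> + weight E \<eta>"
  by (induction E \<xi> rule: weight.induct) (simp_all add: add.assoc)

lemma turns_append: "turns p a (\<xi> @ \<eta>) = turns p a \<xi> + turns p (odometer_carry p a \<xi>) \<eta>"
  by (induction p a \<xi> rule: turns.induct) (simp_all add: add.assoc)

lemma M_map_add: "M_map E p (x + y) = M_map E p x + M_map E p y"
  by (simp add: M_map_def frag_extend_add)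

lemma M_map_diff: "M_map E p (x - y) = M_map E p x - M_map E p y"
  by (simp add: M_map_def frag_extend_diff)

lemma M_map_cmul_of: "M_map E p (frag_cmul n (frag_of e)) =
    frag_cmul (n * int (p e)) (frag_of (head E e)) - frag_cmul n (frag_of (tail E e))"
  by (simp add: M_map_def frag_extend_cmul frag_cmul_diff_distrib2)

locale odometer = wf_digraph E
  for E :: "('v, 'e) pre_digraph" +
  fixes p :: "'e \<Rightarrow> nat"
  assumes pos: "e \<in> arcs E \<Longrightarrow> 0 < p e"
begin

abbreviation Z where "Z \<equiv> odometer_category E p"

abbreviation walk :: "'v \<Rightarrow> ('e \<times> int) list \<Rightarrow> bool" where
  "walk v \<xi> \<equiv> (v, \<xi>) \<in> Mor (path_category (odometer_graph E p))"

abbreviation start :: "'v \<Rightarrow> ('e \<times> int) list \<Rightarrow> 'v" where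
  "start v \<xi> \<equiv> path_src (odometer_graph E p) (v, \<xi>)"

text \<open>\<open>mor v \<xi> a\<close> is the normal form \<open>\<xi> t\<^sup>a\<close>, where \<open>t\<close> generates the copy of the integers at the source of \<open>\<xi>\<close>.\<close>

definition mor :: "'v \<Rightarrow> ('e \<times> int) list \<Rightarrow> int \<Rightarrow> ('v \<times> ('e \<times> int) list) \<times> ('v \<times> int)" where
  "mor v \<xi> a = ((v, \<xi>), (start v \<xi>, a))"

lemma all_pos: "\<forall>e \<in> arcs E. 0 < p e"
  using pos by blast

sublocale Z: small_category Z
  by (rule odometer_small_category[OF wf_digraph_axioms all_pos])

section \<open>Paths with digits, normal forms and their composition\<close>

lemma walk_Nil [simp]: "walk v [] \<longleftrightarrow> v \<in> verts E"
  by (simp add: path_category_def odometer_graph_def)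

lemma start_Nil [simp]: "start v [] = v"
  by (simp add: path_src_def)

lemma start_Cons [simp]: "start v ((e, i) # \<xi>) = start (tail E e) \<xi>"
  by (simp add: path_src_def odometer_graph_def)

lemma walk_Cons [simp]:
  "walk v ((e, i) # \<xi>) \<longleftrightarrow> e \<in> arcs E \<and> 0 \<le> i \<and> i < int (p e) \<and> v = head E e \<and> walk (tail E e) \<xi>"
  by (cases \<xi>) (auto simp: path_category_def odometer_graph_def)

lemma walk_append: "walk v (\<xi> @ \<eta>) \<longleftrightarrow> walk v \<xi> \<and> walk (start v \<xi>) \<eta>"
  if "v \<in> verts E"
  using that
proof (induction \<xi> arbitrary: v)
  case (Cons x \<xi>)
  then show ?case by (cases x) auto
qed auto

lemma start_append: "start v (\<xi> @ \<eta>) = start (start v \<xi>) \<eta>"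
  by (rule path_src_append)

lemma walk_range: "walk v \<xi> \<Longrightarrow> v \<in> verts E"
  by (simp add: path_category_def odometer_graph_def)

lemma walk_start: "walk v \<xi> \<Longrightarrow> start v \<xi> \<in> verts E"
  using path_src_in_verts[OF wf_digraph_odometer_graph[OF wf_digraph_axioms]]
  by (fastforce simp: odometer_graph_def)

lemma walk_act [simp]: "walk v \<xi> \<Longrightarrow> walk v (odometer_act p a \<xi>)"
  using odometer_act_arcs[OF all_pos] by (simp add: odometer_path_iff)

lemma start_act [simp]: "start v (odometer_act p a \<xi>) = start v \<xi>"
  by (simp add: odometer_path_src)

lemma walk_arcs: "walk v \<xi> \<Longrightarrow> set \<xi> \<subseteq> arcs (odometer_graph E p)"
  by (simp add: odometer_path_iff)

lemma act_0: "walk v \<xi> \<Longrightarrow> odometer_act p 0 \<xi> = \<xi>"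
  and carry_0: "walk v \<xi> \<Longrightarrow> odometer_carry p 0 \<xi> = 0"
  using odometer_zero[OF walk_arcs] by blast+

text \<open>The matching condition forces the vertex of the integer part to be the source of the
  path, so a path and an exponent determine a morphism.\<close>

lemma Mor_Z: "Mor Z = {mor v \<xi> a |v \<xi> a. walk v \<xi>}"
  using walk_start
  by (fastforce simp: odometer_category_def zappa_szep_def integer_bundle_def mor_def path_category_def)

lemma mor_in [simp]: "walk v \<xi> \<Longrightarrow> mor v \<xi> a \<in> Mor Z"
  by (auto simp: Mor_Z)

lemma src_mor [simp]: "src Z (mor v \<xi> a) = start v \<xi>"
  by (simp add: odometer_category_def zappa_szep_def integer_bundle_def mor_def)

lemma rng_mor [simp]: "rng Z (mor v \<xi> a) = v"
  by (simp add: odometer_category_def zappa_szep_def path_category_def mor_def)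

lemma Obj_Z [simp]: "Obj Z = verts E"
  by (simp add: odometer_category_def zappa_szep_def integer_bundle_def)

lemma ident_Z [simp]: "ident Z v = mor v [] 0"
  by (simp add: odometer_category_def zappa_szep_def integer_bundle_def path_category_def mor_def)

text \<open>Moving \<open>t^a\<close> past \<open>\<eta>\<close> rewrites the digits and leaves the
  carry as an exponent, so the product of two normal forms is again in normal form.\<close>

lemma comp_mor [simp]:
  "w = start v \<xi> \<Longrightarrow>
    comp Z (mor v \<xi> a) (mor w \<eta> b) = mor v (\<xi> @ odometer_act p a \<eta>) (odometer_carry p a \<eta> + b)"
  by (simp add: odometer_category_def zappa_szep_def integer_bundle_def path_category_def mor_def
      odometer_left_def odometer_right_def start_append)

lemma comp_mor_0:
  "walk w \<eta> \<Longrightarrow> w = start v \<xi> \<Longrightarrow> comp Z (mor v \<xi> 0) (mor w \<eta> b) = mor v (\<xi> @ \<eta>) b"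
  by (simp add: act_0 carry_0)

lemma composableE:
  assumes "x \<in> Mor Z" "y \<in> Mor Z" "src Z x = rng Z y"
  obtains v \<xi> a \<eta> b where "walk v \<xi>" "walk (start v \<xi>) \<eta>" "x = mor v \<xi> a" "y = mor (start v \<xi>) \<eta> b"
  using assms by (auto simp: Mor_Z)

text \<open>With \<open>(e, i) = t^i (e, 0)\<close>, a normal form contains \<open>i\<close>
  generators at \<open>head E e\<close> for each arc \<open>(e, i)\<close> and \<open>a\<close>
  generators at its source.\<close>

definition total_weight ::
  "((('v \<times> ('e \<times> int) list) \<times> ('v \<times> int)) list \<Rightarrow>\<^sub>0 int) \<Rightarrow> 'v \<Rightarrow>\<^sub>0 int" where
  "total_weight = frag_extend
    (\<lambda>es. weight E (snd (fst (hd es))) + frag_cmul (snd (snd (hd es))) (frag_of (fst (snd (hd es)))))"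

text \<open>In a product of normal forms only the exponent of the first factor has to pass the path
  of the second, so these are the two data that matter.\<close>

definition total_turns ::
  "((('v \<times> ('e \<times> int) list) \<times> ('v \<times> int)) list \<Rightarrow>\<^sub>0 int) \<Rightarrow> 'e \<Rightarrow>\<^sub>0 int" where
  "total_turns = frag_extend (\<lambda>es. turns p (snd (snd (es ! 0))) (snd (fst (es ! 1))))"

lemma total_weight_of [simp]:
  "total_weight (frag_of [mor v \<xi> a]) = weight E \<xi> + frag_cmul a (frag_of (start v \<xi>))"
  by (simp add: total_weight_def mor_def)

lemma total_turns_of [simp]: "total_turns (frag_of [mor v \<xi> a, mor w \<eta> b]) = turns p a \<eta>"
  by (simp add: total_turns_def mor_def)

lemma total_weight_add: "total_weight (x + y) = total_weight x + total_weight y"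
  and total_weight_diff: "total_weight (x - y) = total_weight x - total_weight y"
  and total_weight_0: "total_weight 0 = 0"
  by (simp_all add: total_weight_def frag_extend_add frag_extend_diff)

lemma total_turns_add: "total_turns (x + y) = total_turns x + total_turns y"
  and total_turns_diff: "total_turns (x - y) = total_turns x - total_turns y"
  and total_turns_0: "total_turns 0 = 0"
  by (simp_all add: total_turns_def frag_extend_add frag_extend_diff)

text \<open>Passing \<open>(e, i)\<close> with carry \<open>q\<close> trades \<open>q * p(e)\<close>
  generators at the head for \<open>q\<close> at the tail, up to the change of digit; that trade is
  \<open>M\<close> of \<open>q\<close> times \<open>e\<close>. Along a path the intermediate carries
  telescope.\<close>

lemma M_map_turns:
  "walk v \<xi> \<Longrightarrow> M_map E p (turns p a \<xi>) =
    frag_cmul a (frag_of v) + weight E \<xi> - weight E (odometer_act p a \<xi>)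
    - frag_cmul (odometer_carry p a \<xi>) (frag_of (start v \<xi>))"
proof (induction \<xi> arbitrary: v a)
  case Nil
  then show ?case by (simp add: M_map_def)
next
  case (Cons x \<xi>)
  obtain e i where x: "x = (e, i)" by fastforce
  define q where "q = (a + i) div int (p e)"
  have "a + i = q * int (p e) + (a + i) mod int (p e)"
    by (simp add: q_def)
  then have "frag_cmul a (frag_of v) + frag_cmul i (frag_of v) =
      frag_cmul (q * int (p e)) (frag_of v) + frag_cmul ((a + i) mod int (p e)) (frag_of v)"
    by (metis frag_cmul_distrib)
  moreover from Cons.prems x have "v = head E e" "walk (tail E e) \<xi>" by simp_all
  ultimately show ?case
    using Cons.IH[of "tail E e" q]
    by (simp add: x q_def[symmetric] M_map_add M_map_cmul_of algebra_simps)
qed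

text \<open>Adding \<open>b\<close> and then \<open>a\<close> to a digit gives two carries whose sum
  is the carry of \<open>a + b\<close>. These carries are the exponents acting on the rest of the
  path, to which induction applies.\<close>

lemma turns_plus:
  "walk v \<xi> \<Longrightarrow> turns p (a + b) \<xi> = turns p a (odometer_act p b \<xi>) + turns p b \<xi>"
proof (induction \<xi> arbitrary: v a b)
  case (Cons x \<xi>)
  obtain e i where x: "x = (e, i)" by fastforce
  define n where "n = int (p e)"
  define m where "m = (b + i) mod n"
  define q where "q = (b + i) div n"
  from Cons.prems pos x have n: "n \<noteq> 0" by (auto simp: n_def)
  have s: "a + b + i = (a + m) + q * n"
    unfolding m_def q_def using div_mult_mod_eq[of "b + i" n] by linarith
  have "(a + b + i) div n = (a + m) div n + q"
    unfolding s using n by simp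
  then show ?case
    using Cons.IH[of "tail E e" "(a + m) div n" q] Cons.prems
    by (simp add: x n_def[symmetric] m_def[symmetric] q_def[symmetric] frag_cmul_distrib algebra_simps)
qed simp

text \<open>The weights of \<open>x\<close>, \<open>y\<close> and \<open>xy\<close> differ only by
  the new digits of the second path and its carry, which \<open>M_map_turns\<close> accounts for.
  With the next lemma this compares the bar complex with \<open>M\<close> in degrees 1 and
  2.\<close>

lemma total_weight_boundary:
  assumes "Poly_Mapping.keys z \<subseteq> nerve Z (Suc (Suc 0))"
  shows "total_weight (boundary Z (Suc 0) z) = M_map E p (total_turns z)"
  using assms
proof (induction z rule: frag_induction)
  case (one es)
  then obtain v \<xi> a \<eta> b where "walk v \<xi>" "walk (start v \<xi>) \<eta>"
    "es = [mor v \<xi> a, mor (start v \<xi>) \<eta> b]"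
    by (auto simp: nerve_2 elim: composableE)
  then show ?case
    by (simp add: boundary_simplex_1 total_weight_add total_weight_diff weight_append start_append
        M_map_turns frag_cmul_distrib algebra_simps)
qed (simp_all add: boundary_diff total_weight_diff total_turns_diff M_map_diff,
     simp add: boundary_def total_weight_0 total_turns_0 M_map_def)

text \<open>\<open>turns\<close> is a 2-cocycle: after splitting the face \<open>[x, yz]\<close> by
  \<open>turns_append\<close>, the remaining terms cancel by \<open>turns_plus\<close>.\<close>

lemma total_turns_boundary:
  assumes "Poly_Mapping.keys z \<subseteq> nerve Z (Suc (Suc (Suc 0)))"
  shows "total_turns (boundary Z (Suc (Suc 0)) z) = 0"
  using assms
proof (induction z rule: frag_induction)
  case (one es)
  then obtain x y z where xyz: "x \<in> Mor Z" "y \<in> Mor Z" "z \<in> Mor Z" "src Z x = rng Z y"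
    "src Z y = rng Z z" "es = [x, y, z]"
    by (auto simp: nerve_3)
  from composableE[OF xyz(1,2,4)] obtain v \<xi> a \<eta> b where x: "walk v \<xi>" "walk (start v \<xi>) \<eta>"
    "x = mor v \<xi> a" "y = mor (start v \<xi>) \<eta> b" .
  from xyz(3,5) obtain \<zeta> c where "walk (start (start v \<xi>) \<eta>) \<zeta>" "z = mor (start (start v \<xi>) \<eta>) \<zeta> c"
    unfolding x Mor_Z by force
  with x xyz(6) show ?case
    by (simp add: boundary_simplex_2 start_append total_turns_add total_turns_diff turns_append turns_plus)
qed (simp_all add: boundary_diff total_turns_diff, simp add: boundary_def total_turns_0)

subsection \<open>Comparison with the path category\<close>

text \<open>This is functorial although \<open>t\<close> changes digits, because no nonzero power of
  \<open>t\<close> occurs in the image.\<close>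

definition zero_lift :: "'v \<times> 'e list \<Rightarrow> ('v \<times> ('e \<times> int) list) \<times> ('v \<times> int)" where
  "zero_lift = (\<lambda>(v, es). mor v (map (\<lambda>e. (e, 0)) es) 0)"

definition forget :: "('v \<times> ('e \<times> int) list) \<times> ('v \<times> int) \<Rightarrow> 'v \<times> 'e list" where
  "forget = (\<lambda>((v, \<xi>), _). (v, map fst \<xi>))"

text \<open>One loop \<open>t\<close> per vertex; this is a section of
  \<open>total_weight\<close>.\<close>

definition loops :: "('v \<Rightarrow>\<^sub>0 int) \<Rightarrow> (('v \<times> ('e \<times> int) list) \<times> ('v \<times> int)) list \<Rightarrow>\<^sub>0 int" where
  "loops = frag_extend (\<lambda>v. frag_of [mor v [] 1])"

lemma loops_of [simp]: "loops (frag_of v) = frag_of [mor v [] 1]"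
  and loops_add: "loops (x + y) = loops x + loops y"
  and loops_diff: "loops (x - y) = loops x - loops y"
  and loops_cmul: "loops (frag_cmul n x) = frag_cmul n (loops x)"
  and loops_0 [simp]: "loops 0 = 0"
  by (simp_all add: loops_def frag_extend_add frag_extend_diff frag_extend_cmul)

lemma forget_mor [simp]: "forget (mor v \<xi> a) = (v, map fst \<xi>)"
  by (simp add: forget_def mor_def)

lemma forget_zero_lift [simp]: "forget (zero_lift x) = x"
  by (cases x) (simp add: zero_lift_def o_def)

lemma walk_zero_lift: "walk v (map (\<lambda>e. (e, 0)) es) \<longleftrightarrow> (v, es) \<in> Mor (path_category E)"
  by (auto simp: odometer_path_iff o_def) (auto simp: path_category_def odometer_graph_def pos)

lemma start_eq: "start v \<xi> = path_src E (v, map fst \<xi>)"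
  by (rule odometer_path_src)

sublocale E: small_category "path_category E"
  by (rule small_category_path_category[OF wf_digraph_axioms])

sublocale forget: category_functor Z "path_category E" id forget
proof
  fix x assume "x \<in> Obj Z"
  then show "id x \<in> Obj (path_category E)" "forget (ident Z x) = ident (path_category E) (id x)"
    by (simp_all add: path_category_def)
next
  fix x assume "x \<in> Mor Z"
  then obtain v \<xi> a where x: "walk v \<xi>" "x = mor v \<xi> a" by (auto simp: Mor_Z)
  then show "forget x \<in> Mor (path_category E)" by (simp add: odometer_path_iff)
  show "src (path_category E) (forget x) = id (src Z x)"
    "rng (path_category E) (forget x) = id (rng Z x)"
    by (simp_all add: x(2) start_eq) (simp_all add: path_category_def)
  fix y assume "y \<in> Mor Z" "src Z x = rng Z y"
  then obtain \<eta> b where "y = mor (start v \<xi>) \<eta> b" by (auto simp: Mor_Z x(2))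
  then show "forget (comp Z x y) = comp (path_category E) (forget x) (forget y)"
    by (simp add: x(2)) (simp add: path_category_def)
qed

sublocale zero_lift: category_functor "path_category E" Z id zero_lift
proof
  fix e assume "e \<in> Mor (path_category E)"
  then show "zero_lift e \<in> Mor Z" by (cases e) (simp add: zero_lift_def walk_zero_lift)
  show "src Z (zero_lift e) = id (src (path_category E) e)"
    "rng Z (zero_lift e) = id (rng (path_category E) e)"
    by (cases e; simp add: zero_lift_def start_eq o_def, simp add: path_category_def)+
next
  fix e f assume "e \<in> Mor (path_category E)" "f \<in> Mor (path_category E)"
    "src (path_category E) e = rng (path_category E) f"
  moreover obtain v es where e: "e = (v, es)" by fastforce
  moreover obtain w fs where f: "f = (w, fs)" by fastforce
  moreover have comp: "comp (path_category E) (v, es) (x, fs) = (v, es @ fs)" for x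
    by (simp add: path_category_def)
  ultimately have "walk w (map (\<lambda>e. (e, 0)) fs)" "w = start v (map (\<lambda>e. (e, 0)) es)"
    by (simp_all add: walk_zero_lift start_eq o_def) (simp add: path_category_def)
  then show "zero_lift (comp (path_category E) e f) = comp Z (zero_lift e) (zero_lift f)"
    by (simp add: zero_lift_def e f comp comp_mor_0 del: comp_mor)
qed (auto simp: zero_lift_def path_category_def)

text \<open>This is minus the boundary of a composable pair: modulo boundaries, composition becomes
  addition.\<close>

lemma mor_comp_mod_boundaries:
  assumes "walk v \<xi>" "walk (start v \<xi>) \<eta>"
  shows "frag_of [mor v (\<xi> @ odometer_act p a \<eta>) (odometer_carry p a \<eta> + b)]
    - frag_of [mor v \<xi> a] - frag_of [mor (start v \<xi>) \<eta> b] \<in> boundaries Z (Suc 0)"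
proof -
  have "[mor v \<xi> a, mor (start v \<xi>) \<eta> b] \<in> nerve Z (Suc (Suc 0))" using assms by (intro nerve_2I) simp_all
  from additive_subgroup.minus[OF additive_subgroup_boundaries boundary_simplex_in_boundaries[OF this]]
  show ?thesis by (simp add: boundary_simplex_1 algebra_simps)
qed

text \<open>Each arc splits as \<open>t^i (e, 0)\<close>. The powers of \<open>t\<close> become
  multiples of loops, and the arcs with digit 0 reassemble to the zero lift of the underlying
  path.\<close>

lemma mor_mod_boundaries:
  assumes "walk v \<xi>"
  shows "frag_of [mor v \<xi> a] - loops (total_weight (frag_of [mor v \<xi> a]))
    - frag_of [zero_lift (forget (mor v \<xi> a))] \<in> boundaries Z (Suc 0)"
  using assms
proof (induction \<xi> arbitrary: v)
  case Nil
  interpret B: additive_subgroup "boundaries Z (Suc 0)" by (rule additive_subgroup_boundaries)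
  have *: "frag_of [mor v [] n] - frag_cmul n (frag_of [mor v [] 1]) \<in> boundaries Z (Suc 0)" for n
    by (rule additive_mod_int[OF additive_subgroup_boundaries])
      (use mor_comp_mod_boundaries[of v "[]" "[]"] Nil in simp)
  \<comment> \<open>Exponent 0 disposes of the identity, which is the zero lift of the empty
    path.\<close>
  show ?case using B.diff[OF *[of a] *[of 0]] by (simp add: loops_cmul zero_lift_def)
next
  case (Cons x \<xi>)
  interpret B: additive_subgroup "boundaries Z (Suc 0)" by (rule additive_subgroup_boundaries)
  obtain e i where x: "x = (e, i)" by fastforce
  with Cons.prems have e: "e \<in> arcs E" "0 \<le> i" "i < int (p e)" "v = head E e" "walk (tail E e) \<xi>" by auto
  let ?w = "tail E e" and ?es = "map (\<lambda>x. (fst x, 0)) \<xi>"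
  have w: "walk ?w ?es" using e(5) walk_zero_lift[of ?w "map fst \<xi>"] by (simp add: odometer_path_iff o_def)
  have r1: "frag_of [mor v (x # \<xi>) a] - frag_of [mor v [x] 0] - frag_of [mor ?w \<xi> a] \<in> boundaries Z (Suc 0)"
    using mor_comp_mod_boundaries[of v "[x]" \<xi> 0 a] e odometer_zero[OF walk_arcs[OF e(5)]] by (simp add: x)
  \<comment> \<open>Since \<open>i < p(e)\<close>, the product of \<open>t^i\<close> and
    \<open>(e, 0)\<close> is \<open>(e, i)\<close> without carry.\<close>
  have r2: "frag_of [mor v [x] 0] - frag_of [mor v [] i] - frag_of [mor v [(e, 0)] 0] \<in> boundaries Z (Suc 0)"
    using mor_comp_mod_boundaries[of v "[]" "[(e, 0)]" i 0] e by (simp add: x)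
  have r3: "frag_of [mor v [] i] - frag_cmul i (frag_of [mor v [] 1]) \<in> boundaries Z (Suc 0)"
    by (rule additive_mod_int[OF additive_subgroup_boundaries])
      (use mor_comp_mod_boundaries[of v "[]" "[]"] e in simp)
  have r4: "frag_of [mor v ((e, 0) # ?es) 0] - frag_of [mor v [(e, 0)] 0] - frag_of [mor ?w ?es 0]
      \<in> boundaries Z (Suc 0)"
    using mor_comp_mod_boundaries[of v "[(e, 0)]" ?es 0 0] e w odometer_zero[OF walk_arcs[OF w]] by simp
  from B.add[OF B.diff[OF B.add[OF B.add[OF r1 r2] r3] r4] Cons.IH[OF e(5)]] show ?case
    by (simp add: x e(4) loops_add loops_cmul zero_lift_def o_def algebra_simps)
qed

text \<open>The linear extension of \<open>mor_mod_boundaries\<close>; it yields exactness at the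
  middle of the sequence in degree 1.\<close>

lemma chain_mod_boundaries:
  assumes "Poly_Mapping.keys z \<subseteq> nerve Z (Suc 0)"
  shows "z - loops (total_weight z) - chain_map zero_lift (chain_map forget z) \<in> boundaries Z (Suc 0)"
proof -
  interpret B: additive_subgroup "boundaries Z (Suc 0)" by (rule additive_subgroup_boundaries)
  from assms show ?thesis
  proof (induction z rule: frag_induction)
    case zero
    then show ?case by (simp add: total_weight_0 chain_map_def B.zero)
  next
    case (one es)
    then obtain v \<xi> a where "es = [mor v \<xi> a]" "walk v \<xi>" by (auto simp: nerve_Suc_0 Mor_Z)
    then show ?case using mor_mod_boundaries[of v \<xi> a] by simp
  next
    case (diff a b)
    from B.diff[OF this] show ?case
      by (simp add: total_weight_diff chain_map_diff loops_diff algebra_simps)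
  qed
qed

text \<open>The 2-chain filling the relation \<open>t\<^sup>p e = e t\<close>, with \<open>t\<^sup>p\<close> built up one factor \<open>t\<close> at a time.\<close>

definition relator :: "'e \<Rightarrow> (('v \<times> ('e \<times> int) list) \<times> ('v \<times> int)) list \<Rightarrow>\<^sub>0 int" where
  "relator e =
    frag_of [mor (head E e) [] (int (p e)), mor (head E e) [(e, 0)] 0]
    - frag_of [mor (head E e) [(e, 0)] 0, mor (tail E e) [] 1]
    + (\<Sum>j = 1..<p e. frag_of [mor (head E e) [] (int j), mor (head E e) [] 1])"

definition relators :: "('e \<Rightarrow>\<^sub>0 int) \<Rightarrow> (('v \<times> ('e \<times> int) list) \<times> ('v \<times> int)) list \<Rightarrow>\<^sub>0 int" where
  "relators = frag_extend relator"

lemma keys_relator: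
  assumes "e \<in> arcs E" shows "Poly_Mapping.keys (relator e) \<subseteq> nerve Z (Suc (Suc 0))"
proof -
  interpret K: additive_subgroup "{z :: _ \<Rightarrow>\<^sub>0 int. Poly_Mapping.keys z \<subseteq> nerve Z (Suc (Suc 0))}"
    by (rule additive_subgroup_keys)
  have in_nerve: "frag_of [x, y] \<in> {z. Poly_Mapping.keys z \<subseteq> nerve Z (Suc (Suc 0))}"
    if "x \<in> Mor Z" "y \<in> Mor Z" "src Z x = rng Z y" for x y
    using nerve_2I[OF that] by simp
  have "(\<Sum>j\<in>J. frag_of [mor (head E e) [] (int j), mor (head E e) [] 1])
      \<in> {z. Poly_Mapping.keys z \<subseteq> nerve Z (Suc (Suc 0))}" if "finite J" for J
    using that
  proof induction
    case (insert j J)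
    show ?case
      unfolding sum.insert[OF insert.hyps]
      by (intro K.add in_nerve insert.IH) (use assms in simp_all)
  qed (simp add: K.zero)
  then have "relator e \<in> {z. Poly_Mapping.keys z \<subseteq> nerve Z (Suc (Suc 0))}"
    unfolding relator_def using assms pos[OF assms] by (intro K.add K.diff in_nerve) auto
  then show ?thesis by simp
qed

text \<open>The sum over \<open>j\<close> telescopes to \<open>p(e)\<close> times \<open>[t]\<close>
  minus \<open>[t^p(e)]\<close>. The other two pairs have the same composite
  \<open>(e, 0) t\<close>, which cancels, and contribute \<open>[t^p(e)]\<close> minus the loop at
  the tail.\<close>

lemma boundary_relator:
  assumes "e \<in> arcs E"
  shows "boundary Z (Suc 0) (relator e) =
    frag_cmul (int (p e)) (frag_of [mor (head E e) [] 1]) - frag_of [mor (tail E e) [] 1]"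
proof -
  let ?v = "head E e"
  have "boundary Z (Suc 0) (\<Sum>j = 1..<n. frag_of [mor ?v [] (int j), mor ?v [] 1]) =
      frag_cmul (int n) (frag_of [mor ?v [] 1]) - frag_of [mor ?v [] (int n)]" if "0 < n" for n
    using that
  proof (induction n)
    case (Suc n)
    show ?case
    \<comment> \<open>For \<open>n = 0\<close> the sum is empty and \<open>t\<close> is its own
      first power; otherwise the range gains the index \<open>n\<close>.\<close>
    proof (cases "n = 0")
      case False
      with Suc show ?thesis
        by (simp add: boundary_def frag_extend_add frag_cmul_distrib boundary_simplex_1 add.commute)
    qed (simp add: boundary_def)
  qed simp
  from this[OF pos[OF assms]] show ?thesis
    using pos[OF assms]
    by (simp add: relator_def boundary_def frag_extend_add frag_extend_diff boundary_simplex_1)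
qed

lemma boundary_relators:
  assumes "Poly_Mapping.keys k \<subseteq> arcs E"
  shows "boundary Z (Suc 0) (relators k) = loops (M_map E p k)"
  using assms
  by (induction k rule: frag_induction)
    (simp_all add: relators_def frag_extend_diff boundary_diff boundary_relator loops_diff loops_cmul M_map_def,
     simp add: boundary_def)

lemma keys_relators:
  "Poly_Mapping.keys k \<subseteq> arcs E \<Longrightarrow> Poly_Mapping.keys (relators k) \<subseteq> nerve Z (Suc (Suc 0))"
  using frag_extend_mem[OF additive_subgroup_keys, of k "arcs E" relator "nerve Z (Suc (Suc 0))"] keys_relator
  by (simp add: relators_def)

text \<open>Only the first pair of a relator has a nonempty second path, and there
  \<open>t^p(e)\<close> carries exactly once.\<close>

lemma total_turns_relators:
  assumes "Poly_Mapping.keys k \<subseteq> arcs E"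
  shows "total_turns (relators k) = k"
proof -
  have "total_turns (relator e) = frag_of e" if "e \<in> arcs E" for e
    using pos[OF that]
    by (simp add: relator_def total_turns_add total_turns_diff)
      (simp add: total_turns_def frag_extend_sum o_def mor_def)
  with assms show ?thesis
    by (induction k rule: frag_induction)
      (simp_all add: relators_def frag_extend_diff total_turns_diff total_turns_0)
qed

abbreviation B2 where "B2 \<equiv> boundaries Z (Suc (Suc 0))"

subsection \<open>The universal 2-cocycle\<close>

text \<open>
  Modulo boundaries, \<open>(x, y) \<mapsto> [x, y]\<close> is the universal 2-cocycle, so it describes a central
  extension of the odometer category. Below, \<open>lift x\<close> is the central component of the lift of \<open>x\<close>
  that comes from the normal form \<open>\<xi> t\<^sup>a\<close>, with every arc of \<open>\<xi>\<close> written as \<open>t\<^sup>i (e, 0)\<close>, and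
  \<open>defect\<close> is the resulting cohomologous cocycle. It vanishes as long as no carry occurs.
\<close>

definition power_lift :: "'v \<Rightarrow> int \<Rightarrow> (('v \<times> ('e \<times> int) list) \<times> ('v \<times> int)) list \<Rightarrow>\<^sub>0 int" where
  "power_lift v a = (\<Sum>j\<in>{0..<a}. frag_of [mor v [] j, mor v [] 1])
    - (\<Sum>j\<in>{a..<0}. frag_of [mor v [] j, mor v [] 1]) - frag_of [mor v [] 0, mor v [] 1]"

text \<open>One pair is added for each product in \<open>(e, i) \<xi> = (t^i (e, 0)) \<xi>\<close>,
  with \<open>(e, 0)\<close> itself given central component 0. The empty path has the component of
  an identity.\<close>

fun path_lift :: "'v \<Rightarrow> ('e \<times> int) list \<Rightarrow> (('v \<times> ('e \<times> int) list) \<times> ('v \<times> int)) list \<Rightarrow>\<^sub>0 int" where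
  "path_lift v [] = power_lift v 0"
| "path_lift v ((e, i) # \<xi>) = frag_of [mor v [] i, mor v [(e, 0)] 0] + power_lift v i
    + path_lift (tail E e) \<xi> + frag_of [mor v [(e, i)] 0, mor (tail E e) \<xi> 0]"

definition lift where
  "lift = (\<lambda>((v, \<xi>), (w, a)). path_lift v \<xi> + power_lift w a + frag_of [mor v \<xi> 0, mor w [] a])"

definition defect where
  "defect x y = frag_of [x, y] + lift x + lift y - lift (comp Z x y)"

lemma lift_mor: "lift (mor v \<xi> a) =
    path_lift v \<xi> + power_lift (start v \<xi>) a + frag_of [mor v \<xi> 0, mor (start v \<xi>) [] a]"
  by (simp add: lift_def mor_def)

lemma power_lift_0: "power_lift v 0 = - frag_of [mor v [] 0, mor v [] 1]"
  by (simp add: power_lift_def)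

text \<open>The two sums act as one oriented sum from 0 to \<open>a\<close>, so the recursion also
  holds at negative exponents.\<close>

lemma power_lift_Suc: "power_lift v (a + 1) = power_lift v a + frag_of [mor v [] a, mor v [] 1]"
proof (cases "0 \<le> a")
  case True
  then have "{0..<a + 1} = insert a {0..<a}" "{a..<0} = {}" "{a + 1..<0} = {}" by auto
  then show ?thesis by (simp add: power_lift_def)
next
  case False
  then have "{a..<0} = insert a {a + 1..<0}" "{0..<a} = {}" "{0..<a + 1} = {}" by auto
  then show ?thesis by (simp add: power_lift_def)
qed

text \<open>The constant term of \<open>power_lift\<close> is chosen for this normalisation:
  \<open>t\<close> is lifted with central component 0.\<close>

lemma power_lift_1: "power_lift v 1 = 0"
  using power_lift_Suc[of v 0] by (simp add: power_lift_0)

section \<open>Normalisation of the cocycle at identities\<close>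

sublocale B2: additive_subgroup B2
  by (rule additive_subgroup_boundaries)

text \<open>In the boundary of \<open>[1, 1, x]\<close> two of the four faces cancel.\<close>

lemma unit_left:
  assumes "walk v \<xi>"
  shows "frag_of [mor v [] 0, mor v \<xi> a] - frag_of [mor v [] 0, mor v [] 0] \<in> B2"
proof -
  have "[mor v [] 0, mor v [] 0, mor v \<xi> a] \<in> nerve Z (Suc (Suc (Suc 0)))"
    using assms walk_range[OF assms] by (intro nerve_3I) simp_all
  from boundary_simplex_in_boundaries[OF this] show ?thesis
    by (simp add: boundary_simplex_2 act_0[OF assms] carry_0[OF assms])
qed

lemma unit_right:
  assumes "walk v \<xi>" "w = start v \<xi>"
  shows "frag_of [mor v \<xi> a, mor w [] 0] - frag_of [mor w [] 0, mor w [] 0] \<in> B2"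
proof -
  have "[mor v \<xi> a, mor w [] 0, mor w [] 0] \<in> nerve Z (Suc (Suc (Suc 0)))"
    using assms walk_start[OF assms(1)] by (intro nerve_3I) simp_all
  from B2.minus[OF boundary_simplex_in_boundaries[OF this]] show ?thesis
    by (simp add: boundary_simplex_2 assms)
qed

text \<open>The normal form \<open>1 t^a\<close> has an extra identity factor; its pair
  \<open>[1, t^a]\<close> is cancelled by the constant in \<open>power_lift v 0\<close>.\<close>

lemma lift_power:
  assumes "v \<in> verts E" shows "lift (mor v [] a) - power_lift v a \<in> B2"
proof -
  have *: "walk v []" using assms by simp
  from B2.diff[OF unit_left[OF *, of a] unit_left[OF *, of 1]] show ?thesis
    by (simp add: lift_mor power_lift_0)
qed

lemma unit_power_lift:
  assumes "walk v \<xi>" "w = start v \<xi>"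
  shows "power_lift w 0 + frag_of [mor v \<xi> a, mor w [] 0] \<in> B2"
proof -
  have *: "walk w []" using walk_start[OF assms(1)] assms(2) by simp
  from B2.diff[OF unit_right[OF assms, of a] unit_left[OF *, of 1]] show ?thesis
    by (simp add: power_lift_0)
qed

lemma lift_path: "walk v \<xi> \<Longrightarrow> lift (mor v \<xi> 0) - path_lift v \<xi> \<in> B2"
  using unit_power_lift[of v \<xi> "start v \<xi>" 0] by (simp add: lift_mor)

text \<open>\<open>lift\<close> is defined along exactly this product, so only corrections by
  identities remain. The next lemma does the same with the recursion of
  \<open>path_lift\<close>.\<close>

lemma defect_path_power:
  assumes "walk v \<xi>" "w = start v \<xi>" shows "defect (mor v \<xi> 0) (mor w [] a) \<in> B2"
proof -
  have "w \<in> verts E" using walk_start[OF assms(1)] assms(2) by simp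
  from B2.add[OF lift_path[OF assms(1)] lift_power[OF this, of a]] show ?thesis
    by (simp add: defect_def assms(2) lift_mor[of v \<xi> a] algebra_simps)
qed

lemma defect_edge_path:
  assumes "walk v ((e, i) # \<xi>)" "w = tail E e"
  shows "defect (mor v [(e, i)] 0) (mor w \<xi> 0) \<in> B2"
proof -
  from assms have e: "walk v [(e, i)]" and \<xi>: "walk w \<xi>" by auto
  from B2.add[OF B2.diff[OF B2.add[OF lift_path[OF e] lift_path[OF \<xi>]] lift_path[OF assms(1)]]
      unit_power_lift[OF e, of w 0]]
  show ?thesis
    by (simp add: defect_def assms(2) act_0[OF \<xi>[unfolded assms(2)]]
        carry_0[OF \<xi>[unfolded assms(2)]] algebra_simps)
qed

text \<open>The boundary of a triple is the cocycle identity for pairs, and the \<open>lift\<close>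
  terms cancel by associativity. The lemmas below obtain further values of \<open>defect\<close> by
  choosing suitable triples.\<close>

lemma defect_cocycle:
  assumes "walk v \<xi>" "walk w \<eta>" "walk u \<zeta>" "w = start v \<xi>" "u = start w \<eta>"
  shows "defect (mor w \<eta> b) (mor u \<zeta> c) - defect (comp Z (mor v \<xi> a) (mor w \<eta> b)) (mor u \<zeta> c)
    + defect (mor v \<xi> a) (comp Z (mor w \<eta> b) (mor u \<zeta> c)) - defect (mor v \<xi> a) (mor w \<eta> b) \<in> B2"
proof -
  have "mor v \<xi> a \<in> Mor Z" "mor w \<eta> b \<in> Mor Z" "mor u \<zeta> c \<in> Mor Z"
    "src Z (mor v \<xi> a) = rng Z (mor w \<eta> b)" "src Z (mor w \<eta> b) = rng Z (mor u \<zeta> c)"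
    using assms by simp_all
  from Z.comp_assoc[OF this] boundary_simplex_in_boundaries[OF nerve_3I[OF this]] show ?thesis
    by (simp only: boundary_simplex_2 defect_def) (simp add: algebra_simps)
qed

text \<open>The recursion of \<open>power_lift\<close> settles second factor \<open>t\<close>, and
  the triple \<open>(t^a, t^b, t)\<close> shifts the second exponent by one in either
  direction.\<close>

lemma defect_power_power:
  assumes "v \<in> verts E" shows "defect (mor v [] a) (mor v [] b) \<in> B2"
proof (rule int_shift_invariant[of "\<lambda>b. defect (mor v [] a) (mor v [] b) \<in> B2" 1])
  have *: "defect (mor v [] a) (mor v [] 1) \<in> B2" for a
    using B2.diff[OF B2.add[OF lift_power[OF assms, of a] lift_power[OF assms, of 1]] lift_power[OF assms, of "a + 1"]]
    by (simp add: defect_def power_lift_Suc[of v a, unfolded add.commute[of a 1]] power_lift_1 algebra_simps)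
  then show "defect (mor v [] a) (mor v [] 1) \<in> B2" .
  show "defect (mor v [] a) (mor v [] (b + 1)) \<in> B2 \<longleftrightarrow> defect (mor v [] a) (mor v [] b) \<in> B2" for b
    using B2.add[OF B2.diff[OF defect_cocycle[of v "[]" v "[]" v "[]" b 1 a] *[of b]] *[of "a + b"]] assms
    by (intro B2.mem_iff) (simp add: algebra_simps)
qed

text \<open>The triple formed by the first arc, the rest of \<open>\<xi>\<close>, and
  \<open>\<eta>\<close>: two of its values vanish by \<open>defect_edge_path\<close>, and induction
  handles a third.\<close>

lemma defect_path_path:
  "walk v \<xi> \<Longrightarrow> walk w \<eta> \<Longrightarrow> w = start v \<xi> \<Longrightarrow> defect (mor v \<xi> 0) (mor w \<eta> 0) \<in> B2"
proof (induction \<xi> arbitrary: v)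
  case Nil
  have "walk v []" using Nil by simp
  note u = unit_left[OF Nil(2)[unfolded Nil(3)], simplified, of 0] unit_left[OF this, of 1]
    lift_power[of v 0]
  from Nil B2.add[OF B2.diff[OF u(1,2)] u(3)] show ?case
    by (simp add: defect_def act_0 carry_0 power_lift_0 algebra_simps)
next
  case (Cons x \<xi>)
  obtain e i where x: "x = (e, i)" by fastforce
  let ?u = "tail E e"
  have walks: "walk v [(e, i)]" "walk ?u \<xi>" "walk w \<eta>" "w = start ?u \<xi>" "walk ?u (\<xi> @ \<eta>)"
    using Cons.prems walk_append[of ?u \<xi> \<eta>] walk_range[of ?u \<xi>] by (auto simp: x)
  have "walk v ((e, i) # \<xi> @ \<eta>)" using walks Cons.prems by (simp add: x)
  from defect_edge_path[OF this] have 1: "defect (mor v [(e, i)] 0) (mor ?u (\<xi> @ \<eta>) 0) \<in> B2" by simp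
  have 2: "defect (mor v [(e, i)] 0) (mor ?u \<xi> 0) \<in> B2"
    using Cons.prems by (intro defect_edge_path) (simp_all add: x)
  have "?u = start v [(e, i)]" by simp
  note coc = defect_cocycle[OF walks(1,2,3) this walks(4), of 0 0 0]
  from B2.diff[OF B2.add[OF B2.diff[OF Cons.IH[OF walks(2,3,4)] coc] 1] 2] show ?case
    using walks by (simp add: x act_0 carry_0 algebra_simps)
qed

lemma defect_path_any:
  assumes "walk v \<xi>" "walk w \<eta>" "w = start v \<xi>"
  shows "defect (mor v \<xi> 0) (mor w \<eta> b) \<in> B2"
proof -
  let ?u = "start w \<eta>"
  have u: "walk ?u []" using walk_start[OF assms(2)] by simp
  have \<xi>\<eta>: "walk v (\<xi> @ \<eta>)" using assms walk_append[of v \<xi> \<eta>] walk_range[OF assms(1)] by simp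
  have 1: "defect (mor v (\<xi> @ \<eta>) 0) (mor ?u [] b) \<in> B2"
    by (rule defect_path_power[OF \<xi>\<eta>]) (simp add: start_append assms(3))
  note coc = defect_cocycle[OF assms(1,2) u assms(3) refl, of 0 b 0]
  from B2.add[OF B2.diff[OF B2.add[OF coc 1] defect_path_power[OF assms(2) refl, of b]] defect_path_path[OF assms]]
  show ?thesis using assms by (simp add: act_0 carry_0 algebra_simps)
qed

text \<open>From the triple \<open>(\<xi>, t^a, \<eta> t^b)\<close>, in which both values with first
  factor \<open>\<xi>\<close> vanish: a path in front causes no carry.\<close>

lemma defect_strip_path:
  assumes "walk v \<xi>" "walk w \<eta>" "w = start v \<xi>"
  shows "defect (mor v \<xi> a) (mor w \<eta> b) - defect (mor w [] a) (mor w \<eta> b) \<in> B2"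
proof -
  have w: "walk w []" using walk_start[OF assms(1)] assms(3) by simp
  have \<eta>: "walk w (odometer_act p a \<eta>)" using assms(2) by simp
  note coc = defect_cocycle[OF assms(1) w assms(2,3) start_Nil[symmetric], of a b 0]
  from B2.diff[OF B2.diff[OF defect_path_any[OF assms(1) \<eta> assms(3), of "odometer_carry p a \<eta> + b"]
      defect_path_power[OF assms(1,3), of a]] coc]
  show ?thesis using assms by (simp add: algebra_simps)
qed

lemma defect_power_path:
  assumes "walk v \<eta>"
  shows "defect (mor v [] a) (mor v \<eta> b) - defect (mor v [] a) (mor v \<eta> 0) \<in> B2"
proof -
  let ?u = "start v \<eta>"
  have v: "walk v []" and u: "walk ?u []" using walk_range[OF assms] walk_start[OF assms] by simp_all
  have 1: "defect (mor v (odometer_act p a \<eta>) (odometer_carry p a \<eta>)) (mor ?u [] b)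
      - defect (mor ?u [] (odometer_carry p a \<eta>)) (mor ?u [] b) \<in> B2"
    using assms by (intro defect_strip_path u) simp_all
  have 2: "defect (mor ?u [] (odometer_carry p a \<eta>)) (mor ?u [] b) \<in> B2"
    using u by (intro defect_power_power) simp
  note coc = defect_cocycle[OF v assms u start_Nil[symmetric] refl, of 0 b a]
  from B2.diff[OF B2.add[OF B2.add[OF coc 1] 2] defect_path_power[OF assms refl, of b]]
  show ?thesis using assms by (simp add: algebra_simps)
qed

text \<open>From the triple \<open>(t^a, (e, i), \<xi>)\<close>: past the first arc,
  \<open>t^a\<close> becomes \<open>t^q\<close>, and the arc then in front of \<open>t^q\<close> can
  be stripped.\<close>

lemma defect_power_Cons:
  assumes "walk v ((e, i) # \<xi>)" "w = tail E e" "q = (a + i) div int (p e)"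
  shows "defect (mor v [] a) (mor v ((e, i) # \<xi>) 0) - defect (mor v [] a) (mor v [(e, i)] 0)
    - defect (mor w [] q) (mor w \<xi> 0) \<in> B2"
proof -
  have v: "walk v []" and e: "walk v [(e, i)]" and \<xi>: "walk w \<xi>" and w: "w = start v [(e, i)]"
    using assms(1,2) by auto
  have e': "walk v (odometer_act p a [(e, i)])" using e by (rule walk_act)
  note strip = defect_strip_path[OF e' \<xi>, of q 0]
  note coc = defect_cocycle[OF v e \<xi> start_Nil[symmetric] w, of 0 0 a]
  from B2.diff[OF B2.add[OF coc strip] defect_edge_path[OF assms(1,2)]]
  show ?thesis using w by (simp add: assms(3) act_0[OF \<xi>] carry_0[OF \<xi>] algebra_simps)
qed

text \<open>The cocycle on the relation \<open>t^p(e) e = e t\<close>; modulo boundaries all values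
  of \<open>defect\<close> are integer combinations of these.\<close>

definition relation_defect where
  "relation_defect e = defect (mor (head E e) [] (int (p e))) (mor (head E e) [(e, 0)] 0)"

text \<open>No carry occurs, and \<open>path_lift\<close> writes \<open>(e, i)\<close> as this very
  product; what remains are corrections by identities.\<close>

lemma defect_power_digit:
  assumes "e \<in> arcs E" "0 \<le> i" "i < int (p e)" "v = head E e"
  shows "defect (mor v [] i) (mor v [(e, 0)] 0) \<in> B2"
proof -
  have v: "v \<in> verts E" and 0: "walk v [(e, 0)]" and i: "walk v [(e, i)]" using assms by auto
  have vw: "walk v []" using v by simp
  note c = lift_power[OF v, of i] lift_path[OF 0] lift_path[OF i]
    unit_left[OF 0, of 0] unit_left[OF vw, of 1]
    unit_power_lift[OF 0 refl, of 0] unit_power_lift[OF i refl, of 0]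
  from B2.diff[OF B2.add[OF B2.diff[OF B2.add[OF B2.diff[OF B2.add[OF c(1,2)] c(3)] c(4)] c(5)] c(6)] c(7)]
  show ?thesis
    using assms by (simp add: defect_def power_lift_0 algebra_simps)
qed

text \<open>Write \<open>n\<close> as remainder plus a multiple of \<open>p(e)\<close>. The
  remainder causes no carry, and each full \<open>p(e)\<close> uses the relation once.\<close>

lemma defect_power_generator:
  assumes "e \<in> arcs E" "v = head E e"
  shows "defect (mor v [] n) (mor v [(e, 0)] 0) - frag_cmul (n div int (p e)) (relation_defect e) \<in> B2"
proof -
  let ?f = "\<lambda>n. defect (mor v [] n) (mor v [(e, 0)] 0)" and ?p = "int (p e)"
  have v: "walk v []" and e: "walk v [(e, 0)]" and p: "0 < ?p" using assms pos by auto
  \<comment> \<open>Since \<open>t^(p m) e = e t^m\<close>, the triple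
    \<open>(t^n, t^(p m), e)\<close> gives additivity when a multiple of \<open>p(e)\<close> is
    added.\<close>
  have step: "?f (n + ?p * m) - ?f n - ?f (?p * m) \<in> B2" for n m
  proof -
    note coc = defect_cocycle[OF v v e start_Nil[symmetric] start_Nil[symmetric], of "?p * m" 0 n]
    have 1: "defect (mor v [] n) (mor v [(e, 0)] m) - ?f n \<in> B2" by (rule defect_power_path[OF e])
    have 2: "defect (mor v [] n) (mor v [] (?p * m)) \<in> B2" using v by (intro defect_power_power) simp
    from B2.diff[OF B2.diff[OF 1 coc] 2] show ?thesis
      using p by (simp add: algebra_simps)
  qed
  define m where "m = n div ?p"
  have n: "n = n mod ?p + ?p * m" by (simp add: m_def)
  have "?f (?p * m) - frag_cmul m (?f (?p * 1)) \<in> B2"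
    using step by (intro additive_mod_int[OF additive_subgroup_boundaries]) (simp add: distrib_left algebra_simps)
  moreover have "?f (n mod ?p) \<in> B2" using p assms by (intro defect_power_digit) simp_all
  moreover have "?f n - ?f (n mod ?p) - ?f (?p * m) \<in> B2"
    using step[of "n mod ?p" m] n by simp
  ultimately have "(?f n - ?f (n mod ?p) - ?f (?p * m)) + ?f (n mod ?p)
      + (?f (?p * m) - frag_cmul m (?f (?p * 1))) \<in> B2"
    by (intro B2.add)
  then show ?thesis by (simp add: m_def relation_defect_def assms(2) del: minus_frag_cmul)
qed

text \<open>Replacing \<open>(e, i)\<close> by \<open>t^i (e, 0)\<close> moves the digit into the
  exponent, which becomes \<open>a + i\<close>.\<close>

lemma defect_power_edge:
  assumes "walk v [(e, i)]"
  shows "defect (mor v [] a) (mor v [(e, i)] 0) - frag_cmul ((a + i) div int (p e)) (relation_defect e) \<in> B2"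
proof -
  have v: "walk v []" and e: "e \<in> arcs E" "0 \<le> i" "i < int (p e)" "v = head E e" and 0: "walk v [(e, 0)]"
    using assms by auto
  note coc = defect_cocycle[OF v v 0 start_Nil[symmetric] start_Nil[symmetric], of i 0 a]
  have 2: "defect (mor v [] a) (mor v [] i) \<in> B2" using v by (intro defect_power_power) simp
  from B2.diff[OF B2.add[OF B2.add[OF coc 2] defect_power_generator[OF e(1,4), of "a + i"]]
      defect_power_digit[OF e]]
  show ?thesis using e by (simp add: algebra_simps)
qed

lemma defect_power_turns:
  "walk v \<xi> \<Longrightarrow> defect (mor v [] a) (mor v \<xi> 0) - frag_extend relation_defect (turns p a \<xi>) \<in> B2"
proof (induction \<xi> arbitrary: v a)
  case Nil
  then show ?case using defect_power_power by simp
next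
  case (Cons x \<xi>)
  obtain e i where x: "x = (e, i)" by fastforce
  let ?q = "(a + i) div int (p e)"
  have w: "walk v ((e, i) # \<xi>)" "walk v [(e, i)]" "walk (tail E e) \<xi>" using Cons.prems by (auto simp: x)
  from B2.add[OF B2.add[OF defect_power_Cons[OF w(1) refl refl, of a] defect_power_edge[OF w(2), of a]]
      Cons.IH[OF w(3), of ?q]]
  show ?case by (simp add: x frag_extend_add frag_extend_cmul algebra_simps)
qed

lemma defect_turns:
  assumes "walk v \<xi>" "walk w \<eta>" "w = start v \<xi>"
  shows "defect (mor v \<xi> a) (mor w \<eta> b) - frag_extend relation_defect (turns p a \<eta>) \<in> B2"
  using B2.add[OF B2.add[OF defect_strip_path[OF assms, of a b] defect_power_path[OF assms(2), of a b]]
      defect_power_turns[OF assms(2), of a]]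
  by simp

text \<open>The \<open>lift\<close> terms of \<open>defect\<close> depend only on the boundary, so
  they vanish on cycles; the class of a 2-cycle is then determined by
  \<open>total_turns\<close>.\<close>

lemma chain_mod_boundaries_2:
  assumes "Poly_Mapping.keys z \<subseteq> nerve Z (Suc (Suc 0))"
  shows "z + frag_extend (\<lambda>es. lift (hd es)) (boundary Z (Suc 0) z)
    - frag_extend relation_defect (total_turns z) \<in> B2"
  using assms
proof (induction z rule: frag_induction)
  case zero
  then show ?case by (simp add: total_turns_0 boundary_def B2.zero)
next
  case (one es)
  then obtain x y where xy: "x \<in> Mor Z" "y \<in> Mor Z" "src Z x = rng Z y" "es = [x, y]"
    by (auto simp: nerve_2)
  from composableE[OF xy(1-3)] obtain v \<xi> a \<eta> b where w: "walk v \<xi>" "walk (start v \<xi>) \<eta>"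
    "x = mor v \<xi> a" "y = mor (start v \<xi>) \<eta> b" .
  from defect_turns[OF w(1,2) refl, of a b] show ?case
    by (simp add: xy(4) w(3,4) defect_def boundary_simplex_1 frag_extend_add frag_extend_diff algebra_simps)
next
  case (diff a b)
  from B2.diff[OF this] show ?case
    by (simp add: boundary_diff total_turns_diff frag_extend_diff algebra_simps)
qed

subsection \<open>The homology groups\<close>

lemma keys_total_turns:
  assumes "Poly_Mapping.keys z \<subseteq> nerve Z (Suc (Suc 0))"
  shows "Poly_Mapping.keys (total_turns z) \<subseteq> arcs E"
proof -
  let ?K = "{k :: 'e \<Rightarrow>\<^sub>0 int. Poly_Mapping.keys k \<subseteq> arcs E}"
  interpret K: additive_subgroup ?K by (rule additive_subgroup_keys)
  have turns: "turns p a \<eta> \<in> ?K" if "walk w \<eta>" for w \<eta> a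
    using that
  proof (induction \<eta> arbitrary: w a)
    case (Cons x \<eta>)
    obtain e i where x: "x = (e, i)" by fastforce
    with Cons.prems have "e \<in> arcs E" "walk (tail E e) \<eta>" by auto
    then show ?case
      unfolding x turns.simps
      by (intro K.add frag_cmul_mem[OF K.additive_subgroup_axioms] Cons.IH) simp_all
  qed (simp add: K.zero)
  have "turns p (snd (snd (es ! 0))) (snd (fst (es ! 1))) \<in> ?K" if "es \<in> nerve Z (Suc (Suc 0))" for es
  proof -
    from that obtain x y where "x \<in> Mor Z" "y \<in> Mor Z" "es = [x, y]" unfolding nerve_2 by blast
    then obtain w \<eta> b where "walk w \<eta>" "y = mor w \<eta> b" by (auto simp: Mor_Z)
    with turns show ?thesis by (simp add: \<open>es = _\<close> mor_def)
  qed
  from frag_extend_mem[OF K.additive_subgroup_axioms assms this] show ?thesis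
    by (simp add: total_turns_def)
qed

lemma keys_total_weight:
  assumes "Poly_Mapping.keys z \<subseteq> nerve Z (Suc 0)"
  shows "Poly_Mapping.keys (total_weight z) \<subseteq> verts E"
proof -
  let ?K = "{k :: 'v \<Rightarrow>\<^sub>0 int. Poly_Mapping.keys k \<subseteq> verts E}"
  interpret K: additive_subgroup ?K by (rule additive_subgroup_keys)
  note cmul = frag_cmul_mem[OF K.additive_subgroup_axioms]
  have weight: "weight E \<eta> \<in> ?K" if "walk w \<eta>" for w \<eta>
    using that
  proof (induction \<eta> arbitrary: w)
    case (Cons x \<eta>)
    obtain e i where x: "x = (e, i)" by fastforce
    with Cons.prems have "head E e \<in> verts E" "walk (tail E e) \<eta>" by auto
    then show ?case
      unfolding x weight.simps by (intro K.add cmul Cons.IH) simp_all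
  qed (simp add: K.zero)
  have "weight E (snd (fst (hd es))) + frag_cmul (snd (snd (hd es))) (frag_of (fst (snd (hd es)))) \<in> ?K"
    if "es \<in> nerve Z (Suc 0)" for es
  proof -
    from that obtain x where "x \<in> Mor Z" "es = [x]" unfolding nerve_Suc_0 by blast
    then obtain w \<eta> b where "walk w \<eta>" "es = [mor w \<eta> b]" by (auto simp: Mor_Z)
    then show ?thesis
      using K.add[OF weight cmul, of w \<eta> "frag_of (start w \<eta>)" b] walk_start[of w \<eta>]
      by (simp add: mor_def)
  qed
  from frag_extend_mem[OF K.additive_subgroup_axioms assms this] show ?thesis
    by (simp add: total_weight_def)
qed

section \<open>Composites of the comparison maps\<close>

lemma chain_map_forget_zero_lift: "chain_map forget (chain_map zero_lift z) = z"
proof -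
  have "map (\<lambda>x. forget (zero_lift x)) es = es" for es by (simp add: map_idI)
  with subset_UNIV[of "Poly_Mapping.keys z"] show ?thesis
    by (induction z rule: frag_induction) (simp_all add: chain_map_diff o_def, simp_all add: chain_map_def)
qed

text \<open>In degree 0 the basis consists of identities, which have no digits or powers of
  \<open>t\<close> to lose.\<close>

lemma chain_map_zero_lift_forget:
  assumes "Poly_Mapping.keys z \<subseteq> nerve Z 0"
  shows "chain_map zero_lift (chain_map forget z) = z"
  using assms
  by (induction z rule: frag_induction)
    (auto simp: chain_map_diff nerve_def zero_lift_def, simp add: chain_map_def)

lemma total_weight_zero_lift:
  assumes "Poly_Mapping.keys z \<subseteq> nerve (path_category E) (Suc 0)"
  shows "total_weight (chain_map zero_lift z) = 0"
proof -
  have "weight E (map (\<lambda>e. (e, 0)) es) = 0" for es by (induction es) simp_all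
  with assms show ?thesis
    by (induction z rule: frag_induction)
      (auto simp: nerve_Suc_0 zero_lift_def chain_map_diff total_weight_diff,
       simp add: chain_map_def total_weight_0)
qed

lemma loops_in_cycles:
  assumes "Poly_Mapping.keys x \<subseteq> verts E"
  shows "loops x \<in> cycles Z (Suc 0)"
proof -
  have "frag_of [mor v [] 1] \<in> cycles Z (Suc 0)" if "v \<in> verts E" for v
    using that by (simp add: cycles_Suc nerve_1I boundary_simplex_0)
  then show "loops x \<in> cycles Z (Suc 0)"
    unfolding loops_def by (rule frag_extend_mem[OF additive_subgroup_cycles assms])
qed

lemma total_weight_loops: "total_weight (loops x) = x"
  using subset_UNIV[of "Poly_Mapping.keys x"]
  by (induction x rule: frag_induction) (simp_all add: loops_diff total_weight_diff total_weight_0)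

lemma homology_0_iso: "odometer_homology E p 0 \<cong> graph_homology E 0"
  unfolding odometer_homology_def graph_homology_def homology_eq
proof (rule additive_quotient_iso)
  show "chain_map forget ` cycles Z 0 = cycles (path_category E) 0"
  proof (intro equalityI image_subsetI subsetI)
    fix x assume "x \<in> cycles (path_category E) 0"
    then show "x \<in> chain_map forget ` cycles Z 0"
      by (intro image_eqI[of _ _ "chain_map zero_lift x"] zero_lift.chain_map_cycles)
        (simp_all add: chain_map_forget_zero_lift)
  qed (rule forget.chain_map_cycles)
  show "chain_map forget x \<in> boundaries (path_category E) 0 \<longleftrightarrow> x \<in> boundaries Z 0"
    if "x \<in> cycles Z 0" for x
    using that forget.chain_map_boundaries zero_lift.chain_map_boundaries[of "chain_map forget x" 0]
    by (auto simp: cycles_0 chain_map_zero_lift_forget)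
qed (simp_all add: additive_subgroup_cycles additive_subgroup_boundaries Z.boundaries_0_subset_cycles
    E.boundaries_0_subset_cycles chain_map_add)

text \<open>\<open>total_turns\<close> induces the isomorphism: \<open>total_weight_boundary\<close>
  puts its values on cycles in the kernel of \<open>M\<close>, \<open>relators\<close> supplies
  preimages, and \<open>chain_mod_boundaries_2\<close> gives injectivity.\<close>

lemma homology_2_iso: "odometer_homology E p 2 \<cong> ker_M E p"
proof -
  let ?K = "{k \<in> {k. Poly_Mapping.keys k \<subseteq> arcs E}. M_map E p k = 0}"
  have "ker_M E p = additive_group ?K"
    by (simp add: ker_M_def kernel_def additive_group_def) (simp add: free_Abelian_group_def)
  moreover have "additive_group (cycles Z (Suc (Suc 0))) Mod B2 \<cong> additive_group ?K"
  proof (rule additive_quotient_iso_image)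
    show "additive_subgroup ?K"
      by (intro additive_subgroup_ker additive_subgroup_keys M_map_diff)
    show "total_turns ` cycles Z (Suc (Suc 0)) = ?K"
    proof (intro equalityI subsetI)
      fix k assume "k \<in> total_turns ` cycles Z (Suc (Suc 0))"
      then obtain z where "Poly_Mapping.keys z \<subseteq> nerve Z (Suc (Suc 0))" "boundary Z (Suc 0) z = 0"
        "k = total_turns z"
        by (auto simp: cycles_Suc)
      then show "k \<in> ?K" using keys_total_turns total_weight_boundary[of z] by (simp add: total_weight_0)
    next
      fix k assume "k \<in> ?K"
      then show "k \<in> total_turns ` cycles Z (Suc (Suc 0))"
        by (intro image_eqI[of _ _ "relators k"])
          (simp_all add: total_turns_relators cycles_Suc keys_relators boundary_relators)
    qed
    show "total_turns z = 0 \<longleftrightarrow> z \<in> B2" if z: "z \<in> cycles Z (Suc (Suc 0))" for z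
    proof
      assume "total_turns z = 0"
      with z chain_mod_boundaries_2[of z] show "z \<in> B2" by (simp add: cycles_Suc)
    next
      assume "z \<in> B2"
      then show "total_turns z = 0" by (auto simp: boundaries_def total_turns_boundary)
    qed
  qed (simp_all add: additive_subgroup_cycles Z.boundaries_2_subset_cycles total_turns_add)
  ultimately show ?thesis by (simp add: odometer_homology_def homology_eq numeral_2_eq_2)
qed

text \<open>The maps are induced by \<open>zero_lift\<close> and \<open>total_weight\<close>;
  \<open>forget\<close>, \<open>loops\<close> and \<open>relators\<close> provide injectivity,
  surjectivity and exactness in the middle.\<close>

lemma homology_1_short_exact:
  "\<exists>f g. short_exact (graph_homology E 1) (odometer_homology E p 1) (coker_M E p) f g"
proof -
  let ?V = "{x :: 'v \<Rightarrow>\<^sub>0 int. Poly_Mapping.keys x \<subseteq> verts E}" and ?R = "M_map E p ` {k. Poly_Mapping.keys k \<subseteq> arcs E}"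
  have free: "carrier (free_Abelian_group S) = {k. Poly_Mapping.keys k \<subseteq> S}" for S :: "'s set" by auto
  have coker: "coker_M E p = additive_group ?V Mod ?R"
    unfolding coker_M_def free by (simp add: free_Abelian_group_def additive_group_def)
  interpret V: additive_subgroup ?V by (rule additive_subgroup_keys)
  have "M_map E p k \<in> ?V" if "Poly_Mapping.keys k \<subseteq> arcs E" for k
    unfolding M_map_def
    by (rule frag_extend_mem[OF V.additive_subgroup_axioms that], rule V.diff)
      (auto intro: subset_trans[OF keys_cmul])
  then have R: "?R \<subseteq> ?V" by blast
  show ?thesis
    unfolding odometer_homology_def graph_homology_def homology_eq coker One_nat_def
  proof (rule short_exact_additive_quotients)
    show "additive_subgroup ?R" by (intro additive_subgroup_image additive_subgroup_keys M_map_diff)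
    show "chain_map zero_lift ` cycles (path_category E) (Suc 0) \<subseteq> cycles Z (Suc 0)"
      using zero_lift.chain_map_cycles by blast
    show "total_weight ` cycles Z (Suc 0) = ?V"
    proof (intro equalityI subsetI)
      fix x assume "x \<in> ?V"
      then show "x \<in> total_weight ` cycles Z (Suc 0)"
        by (intro image_eqI[of _ _ "loops x"]) (simp_all add: loops_in_cycles total_weight_loops)
    qed (auto simp: cycles_Suc dest: subsetD[OF keys_total_weight])
    show "total_weight ` boundaries Z (Suc 0) \<subseteq> ?R"
      using keys_total_turns by (auto simp: boundaries_def total_weight_boundary)
    show "chain_map zero_lift x \<in> boundaries Z (Suc 0) \<longleftrightarrow> x \<in> boundaries (path_category E) (Suc 0)" for x
      using forget.chain_map_boundaries[of "chain_map zero_lift x" "Suc 0"]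
        zero_lift.chain_map_boundaries[of x "Suc 0"]
      by (auto simp: chain_map_forget_zero_lift)
    show "total_weight (chain_map zero_lift x) \<in> ?R" if "x \<in> cycles (path_category E) (Suc 0)" for x
      using that by (auto simp: cycles_Suc total_weight_zero_lift M_map_def intro!: image_eqI[of _ _ 0])
    show "\<exists>x \<in> cycles (path_category E) (Suc 0). y - chain_map zero_lift x \<in> boundaries Z (Suc 0)"
      if y: "y \<in> cycles Z (Suc 0)" "total_weight y \<in> ?R" for y
    proof
      interpret B: additive_subgroup "boundaries Z (Suc 0)" by (rule additive_subgroup_boundaries)
      from y(2) obtain k where k: "total_weight y = M_map E p k" "Poly_Mapping.keys k \<subseteq> arcs E" by blast
      \<comment> \<open>The weight is \<open>M\<close> of \<open>k\<close>, so the loop part of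
        \<open>y\<close> is the boundary of \<open>relators k\<close> and only the zero lift of
        \<open>forget y\<close> survives.\<close>
      have "loops (total_weight y) \<in> boundaries Z (Suc 0)"
        unfolding boundaries_def k(1) boundary_relators[OF k(2), symmetric] using keys_relators[OF k(2)] by blast
      from B.add[OF chain_mod_boundaries[of y] this] y(1)
      show "y - chain_map zero_lift (chain_map forget y) \<in> boundaries Z (Suc 0)"
        by (simp add: cycles_Suc algebra_simps)
      show "chain_map forget y \<in> cycles (path_category E) (Suc 0)" using y(1) by (rule forget.chain_map_cycles)
    qed
  qed (simp_all only: additive_subgroup_cycles additive_subgroup_boundaries Z.boundaries_1_subset_cycles
      E.boundaries_1_subset_cycles chain_map_add total_weight_add V.additive_subgroup_axioms R)
qed

end

theorem theorem6p15:
  fixes E :: "('v, 'e) pre_digraph" and p :: "'e \<Rightarrow> nat"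
  assumes "fin_digraph E" and "\<forall>e \<in> arcs E. 0 < p e"
  shows "odometer_homology E p 0 \<cong> graph_homology E 0
    \<and> odometer_homology E p 2 \<cong> ker_M E p
    \<and> (\<exists>f g. short_exact (graph_homology E 1) (odometer_homology E p 1) (coker_M E p) f g)"
proof -
  interpret odometer E p
    using assms by (simp add: odometer_def odometer_axioms_def fin_digraph_def)
  show ?thesis using homology_0_iso homology_2_iso homology_1_short_exact by blast
qed

end
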